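(* Let $n\geq 2$ be an integer. Then: (i) if $n\equiv 0 \pmod 3$, then $\Delta_\ell(n)\geq 0$ for all but finitely many positive integers $\ell$; (ii) if $n\equiv 1\pmod 3$, then $\Delta_\ell(n)<0$ for all but finitely many positive integers $\ell$; (iii) if $n\equiv 2\pmod 3$ and $n<20$, then $\Delta_\ell(n)\geq 0$ for all but finitely many positive integers $\ell$; if $n\equiv 2\pmod 3$ and $n\geq 20$, then $\Delta_\ell(n)<0$ for all but finitely many positive integers $\ell$.
   Context: For integers $n\geq 0$ let $S_n$ be the symmetric group on $n$ elements ($S_0$ trivial). For an integer $\ell\geq 1$ let $C_{\ell,n}=\{(\pi_1,\dots,\pi_\ell)\in S_n^\ell : \pi_j\pi_k=\pi_k\pi_j \text{ for all } 1\le j,k\le \ell\}$ and $N_\ell(n)=|C_{\ell,n}|/|S_n|$ (so $N_\ell(0)=1$). Define $\Delta_\ell(n)=N_\ell(n)^2-N_\ell(n-1)N_\ell(n+1)$ for $n\geq 1$. The sequence is called log-concave at $n$ for $\ell$ if $\Delta_\ell(n)\ge 0$, and strictly log-convex at $n$ for $\ell$ if $\Delta_\ell(n)<0$. *)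

theory Defs
  imports "HOL-Combinatorics.Permutations" Complex_Main
begin

definition commuting_tuples :: "nat \<Rightarrow> nat \<Rightarrow> (nat \<Rightarrow> nat) list set" where
  "commuting_tuples l n =
     {ps. length ps = l \<and> (\<forall>p\<in>set ps. p permutes {..<n}) \<and>
          (\<forall>j<l. \<forall>k<l. ps ! j \<circ> ps ! k = ps ! k \<circ> ps ! j)}"

definition N :: "nat \<Rightarrow> nat \<Rightarrow> real" where
  "N l n = real (card (commuting_tuples l n)) / real (card {p. p permutes {..<n}})"

definition Delta :: "nat \<Rightarrow> nat \<Rightarrow> real" where
  "Delta l n = (N l n)^2 - N l (n - 1) * N l (n + 1)"

end

theory Submission
  imports Defs "HOL-Library.Countable_Set"
begin

text \<open>
  Splitting off the orbit of one point gives \<open>n N(n) = (\<Sum>k=1..n. t(k) / (k - 1)! N(n - k))\<close>, where \<open>t(k)\<close>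
  counts the transitive commuting tuples on \<open>k\<close> points. A transitive commuting tuple generates a
  regular abelian group, so \<open>t(k) = r(k) k ^ l + O((k / 2) ^ l)\<close> with \<open>r(k)\<close> the number of regular abelian
  groups of degree \<open>k\<close>, and \<open>r(1), ..., r(4) = 1, 1, 1, 4\<close>. By induction,
  \<open>N(n) = m(n) ^ l (c(n) + (8/9) ^ l (d(n) + o(1)))\<close>, where \<open>m(n)\<close> is the maximal order of an abelian
  permutation group of degree \<open>n\<close>, that is \<open>3 ^ j\<close>, \<open>4 * 3 ^ (j - 1)\<close>, \<open>2 * 3 ^ j\<close> for
  \<open>n = 3j, 3j + 1, 3j + 2\<close> (but \<open>m(1) = 1\<close>). The sign of Delta is that of \<open>m(n)\<^sup>2 - m(n - 1) m(n + 1)\<close>, except when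
  \<open>n = 3j + 2\<close> with \<open>j \<ge> 1\<close>, where this vanishes and the sign of \<open>c(n)\<^sup>2 - c(n - 1) c(n + 1)\<close>, which is that
  of \<open>6 - j\<close>, decides; for \<open>j = 6\<close> the coefficients \<open>d\<close> are needed.
\<close>

subsection \<open>Commuting tuples\<close>

text \<open>An arbitrary point set is allowed because orbits and their complements occur below.
  Commutation is asked of list entries instead of positions, which suits restriction and
  conjugation.\<close>

definition ctuples :: "nat \<Rightarrow> nat set \<Rightarrow> (nat \<Rightarrow> nat) list set" where
  "ctuples l X = {ps. length ps = l \<and> (\<forall>p\<in>set ps. p permutes X) \<and>
     (\<forall>p\<in>set ps. \<forall>q\<in>set ps. p \<circ> q = q \<circ> p)}"

text \<open>Transitivity of the generated group, expressed without forming that group. Stability in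
  one direction suffices on a finite set, since an injective map sending S into itself is onto
  S.\<close>

definition transitive_on :: "nat set \<Rightarrow> (nat \<Rightarrow> nat) list \<Rightarrow> bool" where
  "transitive_on X ps \<longleftrightarrow> (\<forall>S\<subseteq>X. S \<noteq> {} \<and> (\<forall>p\<in>set ps. p ` S \<subseteq> S) \<longrightarrow> S = X)"

definition ttuples :: "nat \<Rightarrow> nat set \<Rightarrow> (nat \<Rightarrow> nat) list set" where
  "ttuples l X = {ps \<in> ctuples l X. transitive_on X ps}"

lemma transitive_onD:
  assumes "transitive_on X ps" "S \<subseteq> X" "S \<noteq> {}" "\<And>p. p \<in> set ps \<Longrightarrow> p ` S \<subseteq> S"
  shows "S = X"
  using assms unfolding transitive_on_def by simp

lemma commuting_tuples_eq_ctuples: "commuting_tuples l n = ctuples l {..<n}"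
  unfolding commuting_tuples_def ctuples_def by (fastforce simp: in_set_conv_nth)

lemma finite_ctuples: "finite X \<Longrightarrow> finite (ctuples l X)"
  by (rule finite_subset[OF _ finite_lists_length_eq[OF finite_permutations, of X l]])
    (auto simp: ctuples_def)

subsection \<open>Conjugation\<close>

lemma permutes_conjugate:
  assumes "bij g" "p permutes X"
  shows "(g \<circ> p \<circ> inv g) permutes (g ` X)"
proof -
  have "bij (g \<circ> p \<circ> inv g)"
    using assms by (intro bij_comp bij_imp_bij_inv) (auto simp: permutes_bij)
  moreover have "(g \<circ> p \<circ> inv g) x = x" if "x \<notin> g ` X" for x
  proof -
    have "inv g x \<notin> X" using that assms(1) by (metis bij_inv_eq_iff imageI)
    then show ?thesis using assms by (simp add: permutes_not_in bij_is_surj surj_f_inv_f)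
  qed
  ultimately show ?thesis unfolding permutes_def bij_iff by blast
qed

lemma conjugate_in_ctuples:
  assumes "bij g" "ps \<in> ctuples l X"
  shows "map (\<lambda>p. g \<circ> p \<circ> inv g) ps \<in> ctuples l (g ` X)"
proof -
  have "(g \<circ> p \<circ> inv g) \<circ> (g \<circ> q \<circ> inv g) = g \<circ> (p \<circ> q) \<circ> inv g" for p q
    using assms(1) by (auto simp: fun_eq_iff bij_is_inj inv_f_f)
  then show ?thesis
    using assms permutes_conjugate[OF assms(1)] by (auto simp: ctuples_def)
qed

lemma conjugate_transitive_on:
  assumes "bij g" "transitive_on X ps"
  shows "transitive_on (g ` X) (map (\<lambda>p. g \<circ> p \<circ> inv g) ps)"
  unfolding transitive_on_def
proof (intro allI impI, elim conjE)
  fix S assume S: "S \<subseteq> g ` X" "S \<noteq> {}"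
    and inv: "\<forall>p\<in>set (map (\<lambda>p. g \<circ> p \<circ> inv g) ps). p ` S \<subseteq> S"
  have "inv g ` S \<subseteq> X" using S(1) assms(1) by (auto simp: bij_is_inj inv_f_f)
  moreover have "p ` (inv g ` S) \<subseteq> inv g ` S" if "p \<in> set ps" for p
  proof
    fix y assume "y \<in> p ` (inv g ` S)"
    then obtain s where s: "s \<in> S" "y = p (inv g s)" by auto
    then have "g y \<in> S" using inv that by auto
    then show "y \<in> inv g ` S" using assms(1) by (metis bij_is_inj imageI inv_f_f)
  qed
  ultimately have "inv g ` S = X"
    using S(2) by (intro transitive_onD[OF assms(2)]) auto
  then show "S = g ` X" using assms(1) by (metis bij_is_surj image_f_inv_f)
qed

lemma bij_conjugate:
  assumes "bij (g :: nat \<Rightarrow> nat)"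
  shows "map (\<lambda>p. inv g \<circ> p \<circ> inv (inv g)) (map (\<lambda>p. g \<circ> p \<circ> inv g) ps) = ps"
    and "map (\<lambda>p. g \<circ> p \<circ> inv g) (map (\<lambda>p. inv g \<circ> p \<circ> inv (inv g)) ps) = ps"
proof -
  have "inv g \<circ> (g \<circ> p \<circ> inv g) \<circ> inv (inv g) = p"
    "g \<circ> (inv g \<circ> p \<circ> inv (inv g)) \<circ> inv g = p" for p
    using assms by (simp_all add: fun_eq_iff inv_inv_eq bij_is_inj bij_is_surj surj_f_inv_f inv_f_f)
  then show "map (\<lambda>p. inv g \<circ> p \<circ> inv (inv g)) (map (\<lambda>p. g \<circ> p \<circ> inv g) ps) = ps"
    and "map (\<lambda>p. g \<circ> p \<circ> inv g) (map (\<lambda>p. inv g \<circ> p \<circ> inv (inv g)) ps) = ps"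
    by (simp_all add: o_def map_idI)
qed

lemma card_tuples_image:
  assumes "bij g"
  shows "card (ctuples l (g ` X)) = card (ctuples l X)"
    and "card (ttuples l (g ` X)) = card (ttuples l X)"
proof -
  have b: "bij (inv g)" using assms by (rule bij_imp_bij_inv)
  have i: "inv g ` g ` X = X" using assms by (simp add: bij_is_inj)
  let ?f = "map (\<lambda>p. g \<circ> p \<circ> inv g)" and ?h = "map (\<lambda>p. inv g \<circ> p \<circ> inv (inv g))"
  have "bij_betw ?f (ctuples l X) (ctuples l (g ` X))"
    using bij_conjugate[OF assms] conjugate_in_ctuples[OF assms] conjugate_in_ctuples[OF b, of _ l "g ` X"] i
    by (intro bij_betw_byWitness[where f' = ?h]) auto
  moreover have "bij_betw ?f (ttuples l X) (ttuples l (g ` X))"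
    using bij_conjugate[OF assms] conjugate_in_ctuples[OF assms] conjugate_in_ctuples[OF b, of _ l "g ` X"] i
      conjugate_transitive_on[OF assms] conjugate_transitive_on[OF b, of "g ` X"]
    by (intro bij_betw_byWitness[where f' = ?h]) (auto simp: ttuples_def)
  ultimately show "card (ctuples l (g ` X)) = card (ctuples l X)"
    and "card (ttuples l (g ` X)) = card (ttuples l X)"
    by (auto dest: bij_betw_same_card)
qed

text \<open>Permutations are functions on all of \<open>nat\<close>, so conjugation needs a
  bijection of the whole type. One between X and Y extends because both complements are countably
  infinite.\<close>

lemma ex_bij_image_eq:
  fixes X Y :: "nat set"
  assumes "finite X" "finite Y" "card X = card Y"
  shows "\<exists>g. bij g \<and> g ` X = Y"
proof -
  have "infinite (- X)" "infinite (- Y)" using assms by (simp_all add: finite_compl)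
  then have "bij_betw (from_nat_into (- Y) \<circ> to_nat_on (- X)) (- X) (- Y)"
    by (intro bij_betw_trans[OF to_nat_on_infinite bij_betw_from_nat_into]) auto
  moreover obtain f where f: "bij_betw f X Y"
    using assms finite_same_card_bij by blast
  ultimately obtain h where h: "bij_betw h (- X) (- Y)" by blast
  define g where "g x = (if x \<in> X then f x else h x)" for x
  have "bij_betw g (X \<union> - X) (Y \<union> - Y)"
    unfolding g_def using f h by (intro bij_betw_disjoint_Un) auto
  moreover have "g ` X = Y" using f by (simp add: g_def bij_betw_def)
  ultimately show ?thesis by auto
qed

lemma card_tuples_lessThan:
  assumes "finite X"
  shows "card (ctuples l X) = card (ctuples l {..<card X})"
    and "card (ttuples l X) = card (ttuples l {..<card X})"
proof -
  obtain g where "bij g" "g ` {..<card X} = X" using ex_bij_image_eq[of "{..<card X}" X] assms by auto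
  then show "card (ctuples l X) = card (ctuples l {..<card X})"
    and "card (ttuples l X) = card (ttuples l {..<card X})"
    using card_tuples_image[of g l "{..<card X}"] by auto
qed

subsection \<open>Splitting off an orbit\<close>

text \<open>Extension by the identity makes the restriction to a stable set S a permutation of S in
  the sense of \<open>permutes\<close>.\<close>

definition restr :: "nat set \<Rightarrow> (nat \<Rightarrow> nat) \<Rightarrow> nat \<Rightarrow> nat" where
  "restr S p x = (if x \<in> S then p x else x)"

lemma permutes_invariant_image:
  assumes "p permutes X" "finite S" "p ` S \<subseteq> S"
  shows "p ` S = S"
proof (rule card_subset_eq[OF assms(2,3)])
  show "card (p ` S) = card S"
    using permutes_inj[OF assms(1)] by (metis card_image inj_on_subset subset_UNIV)
qed

lemma permutes_invariant_diff:
  assumes "p permutes X" "finite S" "p ` S \<subseteq> S"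
  shows "p ` (X - S) \<subseteq> X - S"
proof -
  have "p ` (X - S) = p ` X - p ` S" using permutes_inj[OF assms(1)] by (simp add: image_set_diff)
  then show ?thesis using permutes_invariant_image[OF assms] permutes_image[OF assms(1)] by simp
qed

lemma restr_permutes:
  assumes "p permutes X" "finite S" "p ` S \<subseteq> S"
  shows "restr S p permutes S"
proof (rule bij_imp_permutes)
  have "bij_betw p S S"
    using permutes_invariant_image[OF assms] permutes_inj[OF assms(1)]
    by (metis bij_betw_def inj_on_subset subset_UNIV)
  then show "bij_betw (restr S p) S S" by (rule bij_betw_cong[THEN iffD1, rotated]) (simp add: restr_def)
qed (simp add: restr_def)

lemma restr_comp:
  "q ` S \<subseteq> S \<Longrightarrow> restr S p \<circ> restr S q = restr S (p \<circ> q)"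
  by (auto simp: restr_def fun_eq_iff)

lemma restr_comp_diff:
  assumes "p permutes X" "finite S" "p ` S \<subseteq> S"
  shows "restr S p \<circ> restr (X - S) p = p"
proof
  fix x
  show "(restr S p \<circ> restr (X - S) p) x = p x"
    using permutes_invariant_diff[OF assms] permutes_not_in[OF assms(1), of x]
    by (cases "x \<in> X") (auto simp: restr_def)
qed

lemma disjoint_permutes_commute:
  assumes "q permutes S" "r permutes R" "S \<inter> R = {}"
  shows "q \<circ> r = r \<circ> q"
proof
  fix x
  show "(q \<circ> r) x = (r \<circ> q) x"
    using assms(3) permutes_in_image[OF assms(1), of x] permutes_in_image[OF assms(2), of x]
      permutes_not_in[OF assms(1)] permutes_not_in[OF assms(2)]
    by (cases "x \<in> S"; cases "x \<in> R") (auto simp: disjoint_iff)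
qed

lemma restr_disjoint_comp:
  assumes "q permutes S" "r permutes R" "S \<inter> R = {}"
  shows "restr S (q \<circ> r) = q" "restr R (q \<circ> r) = r"
proof -
  show "restr S (q \<circ> r) = q"
    using assms(3) permutes_not_in[OF assms(1)] permutes_not_in[OF assms(2)]
    by (auto simp: restr_def fun_eq_iff disjoint_iff)
  show "restr R (q \<circ> r) = r"
    using assms(3) permutes_not_in[OF assms(1)] permutes_not_in[OF assms(2)] permutes_in_image[OF assms(2)]
    by (auto simp: restr_def fun_eq_iff disjoint_iff)
qed

text \<open>Restriction to S and to X - S is inverted by entrywise composition. The composed tuple
  commutes because permutations with disjoint supports commute.\<close>

lemma ctuples_Diff_correspondence:
  assumes X: "finite X" "S \<subseteq> X"
  shows "card {ps \<in> ctuples l X. (\<forall>p\<in>set ps. p ` S \<subseteq> S) \<and> transitive_on S ps}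
    = card (ttuples l S) * card (ctuples l (X - S))" (is "card ?A = _")
proof -
  let ?f = "\<lambda>ps. (map (restr S) ps, map (restr (X - S)) ps)"
  let ?g = "\<lambda>(qs, rs). map2 (\<circ>) qs rs"
  have fS: "finite S" using X finite_subset by blast
  \<comment> \<open>Transitivity on S only sees values on subsets of S, where restriction changes
    nothing.\<close>
  have cong: "transitive_on S (map (restr S) ps) \<longleftrightarrow> transitive_on S ps" for ps
  proof -
    have "restr S p ` U = p ` U" if "U \<subseteq> S" for p U
      using that by (auto simp: restr_def image_iff subset_iff)
    then show ?thesis unfolding transitive_on_def by (auto 0 4)
  qed
  have "bij_betw ?f ?A (ttuples l S \<times> ctuples l (X - S))"
  proof (rule bij_betw_byWitness[where f' = ?g])
    show "\<forall>ps\<in>?A. ?g (?f ps) = ps"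
      using restr_comp_diff[OF _ fS]
      by (auto simp: zip_map_map zip_same_conv_map ctuples_def intro!: map_idI)
    show "\<forall>qr\<in>ttuples l S \<times> ctuples l (X - S). ?f (?g qr) = qr"
    proof
      fix qr assume "qr \<in> ttuples l S \<times> ctuples l (X - S)"
      then obtain qs rs where qr: "qr = (qs, rs)" and qs: "qs \<in> ttuples l S" and rs: "rs \<in> ctuples l (X - S)"
        by blast
      then have len: "length qs = length rs" by (auto simp: ttuples_def ctuples_def)
      have *: "restr S (q \<circ> r) = q" "restr (X - S) (q \<circ> r) = r" if "(q, r) \<in> set (zip qs rs)" for q r
        using restr_disjoint_comp[of q S r "X - S"] set_zip_leftD[OF that] set_zip_rightD[OF that] qs rs
        by (auto simp: ttuples_def ctuples_def)
      have "map (restr S) (map2 (\<circ>) qs rs) = map fst (zip qs rs)"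
        "map (restr (X - S)) (map2 (\<circ>) qs rs) = map snd (zip qs rs)"
        using * by auto
      then show "?f (?g qr) = qr" using len by (simp add: qr)
    qed
    show "?f ` ?A \<subseteq> ttuples l S \<times> ctuples l (X - S)"
    proof (rule image_subsetI)
      fix ps assume "ps \<in> ?A"
      then have ps: "ps \<in> ctuples l X" "\<forall>p\<in>set ps. p ` S \<subseteq> S" "transitive_on S ps" by auto
      have inv: "\<forall>p\<in>set ps. p ` (X - S) \<subseteq> X - S"
        using ps(1,2) permutes_invariant_diff[OF _ fS, of _ X] by (simp add: ctuples_def)
      have "map (restr S) ps \<in> ctuples l S"
        using ps(1,2) restr_permutes[of _ X S] fS unfolding ctuples_def by (simp add: restr_comp)
      moreover have "map (restr (X - S)) ps \<in> ctuples l (X - S)"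
        using ps(1) inv restr_permutes[of _ X "X - S"] X unfolding ctuples_def by (simp add: restr_comp)
      ultimately show "?f ps \<in> ttuples l S \<times> ctuples l (X - S)"
        using ps(3) by (simp add: ttuples_def cong)
    qed
    show "?g ` (ttuples l S \<times> ctuples l (X - S)) \<subseteq> ?A"
    proof (rule image_subsetI)
      fix qr assume "qr \<in> ttuples l S \<times> ctuples l (X - S)"
      then obtain qs rs where qr: "qr = (qs, rs)" and qs: "qs \<in> ttuples l S" and rs: "rs \<in> ctuples l (X - S)"
        by blast
      then have len: "length qs = length rs" by (auto simp: ttuples_def ctuples_def)
      let ?ps = "map2 (\<circ>) qs rs"
      have z: "q permutes S" "r permutes X - S" "q \<in> set qs" "r \<in> set rs"
        if "(q, r) \<in> set (zip qs rs)" for q r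
        using set_zip_leftD[OF that] set_zip_rightD[OF that] qs rs by (auto simp: ttuples_def ctuples_def)
      have perm: "p permutes X" if "p \<in> set ?ps" for p
        using that z X(2) by (auto intro!: permutes_compose intro: permutes_subset[OF z(1)] permutes_subset[OF z(2)])
      have inv: "p ` S \<subseteq> S" if p: "p \<in> set ?ps" for p
      proof -
        obtain q r where qr: "(q, r) \<in> set (zip qs rs)" "p = q \<circ> r" using p by auto
        then show ?thesis
          using permutes_not_in[OF z(2)[OF qr(1)]] permutes_in_image[OF z(1)[OF qr(1)]] by auto
      qed
      have comm: "p \<circ> p' = p' \<circ> p" if p: "p \<in> set ?ps" and p': "p' \<in> set ?ps" for p p'
      proof -
        obtain q r where qr: "(q, r) \<in> set (zip qs rs)" "p = q \<circ> r" using p by auto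
        obtain q' r' where qr': "(q', r') \<in> set (zip qs rs)" "p' = q' \<circ> r'" using p' by auto
        have "q \<circ> q' = q' \<circ> q" "r \<circ> r' = r' \<circ> r"
          using z(3,4)[OF qr(1)] z(3,4)[OF qr'(1)] qs rs by (auto simp: ttuples_def ctuples_def)
        moreover have "r \<circ> q' = q' \<circ> r" "r' \<circ> q = q \<circ> r'"
          using disjoint_permutes_commute[OF z(1)[OF qr'(1)] z(2)[OF qr(1)]]
            disjoint_permutes_commute[OF z(1)[OF qr(1)] z(2)[OF qr'(1)]] by auto
        ultimately show ?thesis unfolding qr(2) qr'(2) by (metis comp_assoc)
      qed
      have "map (restr S) ?ps = map fst (zip qs rs)"
        using restr_disjoint_comp(1) z by fastforce
      then have "transitive_on S ?ps" using qs len cong[of ?ps] by (simp add: ttuples_def)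
      then have "?ps \<in> ctuples l X \<and> (\<forall>p\<in>set ?ps. p ` S \<subseteq> S) \<and> transitive_on S ?ps"
        using perm inv comm len rs unfolding ctuples_def by simp
      then show "?g qr \<in> ?A" by (simp add: qr)
    qed
  qed
  then show ?thesis by (simp add: bij_betw_same_card card_cartesian_product)
qed

text \<open>Each tuple is sorted by the orbit S of x under the group it generates.\<close>

lemma card_ctuples_orbit:
  assumes X: "finite X" "x \<in> X"
  shows "card (ctuples l X) =
    (\<Sum>S | S \<subseteq> X \<and> x \<in> S. card (ttuples l S) * card (ctuples l (X - S)))"
proof -
  let ?A = "\<lambda>S. {ps \<in> ctuples l X. (\<forall>p\<in>set ps. p ` S \<subseteq> S) \<and> transitive_on S ps}"
  let ?I = "{S. S \<subseteq> X \<and> x \<in> S}"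
  have fin: "finite ?I" using X by simp
  have cover: "\<exists>S\<in>?I. ps \<in> ?A S" if ps: "ps \<in> ctuples l X" for ps
  proof -
    \<comment> \<open>The orbit of x is obtained as a minimal stable set containing x.\<close>
    define F where "F = {S. S \<subseteq> X \<and> x \<in> S \<and> (\<forall>p\<in>set ps. p ` S \<subseteq> S)}"
    have "X \<in> F" using ps X permutes_image by (fastforce simp: F_def ctuples_def)
    moreover have "finite F" using X by (simp add: F_def)
    ultimately obtain S where S: "S \<in> F" and min: "\<And>T. T \<in> F \<Longrightarrow> T \<subseteq> S \<Longrightarrow> T = S"
      using finite_has_minimal[of F] by blast
    have fS: "finite S" using S X by (auto simp: F_def intro: finite_subset)
    have "transitive_on S ps" unfolding transitive_on_def
    proof (intro allI impI, elim conjE)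
      fix U assume U: "U \<subseteq> S" "U \<noteq> {}" "\<forall>p\<in>set ps. p ` U \<subseteq> U"
      show "U = S"
      proof (cases "x \<in> U")
        case True
        then show ?thesis using U S by (intro min) (auto simp: F_def)
      next
        case False
        \<comment> \<open>If U misses x, its complement in S is again stable and contains x, so
          minimality of S forces U to be empty.\<close>
        have "p ` (S - U) \<subseteq> S - U" if "p \<in> set ps" for p
        proof -
          have p: "p permutes X" using ps that by (simp add: ctuples_def)
          have "p ` (S - U) = p ` S - p ` U" using permutes_inj[OF p] by (simp add: image_set_diff)
          moreover have "p ` U = U" using U that fS
            by (intro permutes_invariant_image[OF p]) (auto intro: finite_subset)
          moreover have "p ` S \<subseteq> S" using S that by (auto simp: F_def)
          ultimately show ?thesis by auto
        qed
        then have "S - U \<in> F" using False S by (auto simp: F_def)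
        then have "S - U = S" by (intro min) auto
        then show ?thesis using U by blast
      qed
    qed
    then show ?thesis using S ps by (auto simp: F_def)
  qed
  \<comment> \<open>The intersection contains x and is stable, so transitivity on S and on S' makes
    it equal to both.\<close>
  have disj: "S = S'" if "x \<in> S" "x \<in> S'" and S: "ps \<in> ?A S" "ps \<in> ?A S'" for S S' ps
  proof -
    have "S \<inter> S' \<noteq> {}" "\<forall>p\<in>set ps. p ` (S \<inter> S') \<subseteq> S \<inter> S'" using that by blast+
    moreover have "transitive_on S ps" "transitive_on S' ps" using S by simp_all
    ultimately have "S \<inter> S' = S" "S \<inter> S' = S'" unfolding transitive_on_def by (meson inf_le1 inf_le2)+
    then show ?thesis by simp
  qed
  have "ctuples l X = (\<Union>S\<in>?I. ?A S)"
  proof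
    show "ctuples l X \<subseteq> (\<Union>S\<in>?I. ?A S)" using cover by (intro subsetI) (simp only: UN_iff)
  qed auto
  then have "card (ctuples l X) = card (\<Union>S\<in>?I. ?A S)" by simp
  also have "\<dots> = (\<Sum>S\<in>?I. card (?A S))"
  proof (rule card_UN_disjoint[OF fin])
    show "\<forall>S\<in>?I. finite (?A S)" using finite_ctuples[OF X(1)] by simp
    show "\<forall>S\<in>?I. \<forall>S'\<in>?I. S \<noteq> S' \<longrightarrow> ?A S \<inter> ?A S' = {}"
    proof (intro ballI impI, rule ccontr)
      fix S S' assume S: "S \<in> ?I" "S' \<in> ?I" "S \<noteq> S'" and "?A S \<inter> ?A S' \<noteq> {}"
      then obtain ps where "ps \<in> ?A S" "ps \<in> ?A S'" by (elim ex_in_conv[THEN iffD2, THEN exE] IntE)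
      then show False using disj[of S S' ps] S by simp
    qed
  qed
  also have "\<dots> = (\<Sum>S\<in>?I. card (ttuples l S) * card (ctuples l (X - S)))"
    using ctuples_Diff_correspondence[OF X(1)] by (intro sum.cong) auto
  finally show ?thesis .
qed

section \<open>Recurrence by orbit size\<close>

lemma sum_Pow_card:
  fixes f :: "nat \<Rightarrow> 'b::comm_semiring_1"
  assumes "finite A"
  shows "(\<Sum>S\<in>Pow A. f (card S)) = (\<Sum>j\<le>card A. of_nat (card A choose j) * f j)"
proof -
  have "(\<Sum>S\<in>Pow A. f (card S)) = (\<Sum>j\<le>card A. \<Sum>S | S \<in> Pow A \<and> card S = j. f (card S))"
    using assms by (intro sum.group[symmetric]) (auto intro: card_mono)
  also have "\<dots> = (\<Sum>j\<le>card A. \<Sum>S | S \<in> Pow A \<and> card S = j. f j)"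
    by (intro sum.cong) auto
  also have "\<dots> = (\<Sum>j\<le>card A. of_nat (card A choose j) * f j)"
    using n_subsets[OF assms] by simp
  finally show ?thesis .
qed

text \<open>The distinguished point is n. Its orbit is n together with a j-element subset of
  \<open>{..<n}\<close>, hence the binomial coefficient and the orbit size
  \<open>Suc j\<close>.\<close>

lemma card_ctuples_Suc:
  "card (ctuples l {..<Suc n}) = (\<Sum>j\<le>n. (n choose j) * (card (ttuples l {..<Suc j}) * card (ctuples l {..<n - j})))"
proof -
  have I: "{S. S \<subseteq> {..<Suc n} \<and> n \<in> S} = insert n ` Pow {..<n}"
  proof (intro set_eqI iffI)
    fix S assume S: "S \<in> {S. S \<subseteq> {..<Suc n} \<and> n \<in> S}"
    then have "S = insert n (S - {n})" "S - {n} \<in> Pow {..<n}" by (auto simp: less_Suc_eq)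
    then show "S \<in> insert n ` Pow {..<n}" by blast
  qed auto
  have inj: "inj_on (insert n) (Pow {..<n})"
    by (rule inj_onI) (metis Pow_iff insert_ident lessThan_iff less_irrefl subsetD)
  let ?h = "\<lambda>j. card (ttuples l {..<Suc j}) * card (ctuples l {..<n - j})"
  have "card (ctuples l {..<Suc n}) =
    (\<Sum>S\<in>insert n ` Pow {..<n}. card (ttuples l S) * card (ctuples l ({..<Suc n} - S)))"
    using card_ctuples_orbit[of "{..<Suc n}" n l] I by simp
  also have "\<dots> = (\<Sum>S\<in>Pow {..<n}. card (ttuples l (insert n S)) * card (ctuples l ({..<Suc n} - insert n S)))"
    by (simp add: sum.reindex[OF inj])
  also have "\<dots> = (\<Sum>S\<in>Pow {..<n}. ?h (card S))"
  proof (rule sum.cong[OF refl])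
    fix S assume S: "S \<in> Pow {..<n}"
    then have f: "finite S" and n: "n \<notin> S" by (auto intro: finite_subset)
    then have c: "card (insert n S) = Suc (card S)" by simp
    moreover have "card ({..<Suc n} - insert n S) = n - card S"
      using S f c by (subst card_Diff_subset) auto
    ultimately show "card (ttuples l (insert n S)) * card (ctuples l ({..<Suc n} - insert n S)) = ?h (card S)"
      using card_tuples_lessThan(2)[of "insert n S" l] card_tuples_lessThan(1)[of "{..<Suc n} - insert n S" l] f
      by simp
  qed
  also have "\<dots> = (\<Sum>j\<le>n. (n choose j) * ?h j)" using sum_Pow_card[of "{..<n}" ?h] by simp
  finally show ?thesis .
qed

lemma N_eq: "N l n = real (card (ctuples l {..<n})) / fact n"
  by (simp add: N_def commuting_tuples_eq_ctuples card_permutations)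

text \<open>Dividing by n! splits the binomial coefficient into 1/j!, which stays with the orbit,
  and 1/(n - j)!, which turns the remaining count into \<open>N l (n - j)\<close>.\<close>

lemma N_Suc:
  "real (Suc n) * N l (Suc n) = (\<Sum>j\<le>n. real (card (ttuples l {..<Suc j})) / fact j * N l (n - j))"
proof -
  have "real (Suc n) * N l (Suc n) = real (card (ctuples l {..<Suc n})) / fact n"
    unfolding N_eq fact_Suc by (simp del: of_nat_Suc)
  also have "\<dots> = (\<Sum>j\<le>n. real (n choose j) / fact n * (real (card (ttuples l {..<Suc j})) * real (card (ctuples l {..<n - j}))))"
    unfolding card_ctuples_Suc by (simp add: sum_divide_distrib)
  also have "\<dots> = (\<Sum>j\<le>n. real (card (ttuples l {..<Suc j})) / fact j * N l (n - j))"
    by (intro sum.cong) (auto simp: N_eq binomial_fact field_simps)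
  finally show ?thesis .
qed

subsection \<open>Regular abelian permutation groups\<close>

text \<open>Closure under composition follows from commutation and sharp transitivity.\<close>
definition regular_abelian :: "nat set \<Rightarrow> (nat \<Rightarrow> nat) set set" where
  "regular_abelian X = {G. (\<forall>g\<in>G. g permutes X) \<and> (\<forall>g\<in>G. \<forall>h\<in>G. g \<circ> h = h \<circ> g) \<and>
     (\<forall>x\<in>X. \<forall>y\<in>X. \<exists>!g. g \<in> G \<and> g x = y)}"

lemma regular_abelianD:
  assumes "G \<in> regular_abelian X"
  shows regular_abelian_permutes: "g \<in> G \<Longrightarrow> g permutes X"
    and regular_abelian_commute: "g \<in> G \<Longrightarrow> h \<in> G \<Longrightarrow> g \<circ> h = h \<circ> g"
    and regular_abelian_transitive: "x \<in> X \<Longrightarrow> y \<in> X \<Longrightarrow> \<exists>g\<in>G. g x = y"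
    and regular_abelian_free: "g \<in> G \<Longrightarrow> h \<in> G \<Longrightarrow> x \<in> X \<Longrightarrow> g x = h x \<Longrightarrow> g = h"
proof -
  show perm: "g permutes X" if "g \<in> G" for g using assms that by (simp add: regular_abelian_def)
  show "g \<circ> h = h \<circ> g" if "g \<in> G" "h \<in> G" using assms that by (simp add: regular_abelian_def)
  have ex1: "\<exists>!g. g \<in> G \<and> g x = y" if "x \<in> X" "y \<in> X" for x y
    using assms that by (simp add: regular_abelian_def)
  then show "\<exists>g\<in>G. g x = y" if "x \<in> X" "y \<in> X" using that by blast
  show "g = h" if "g \<in> G" "h \<in> G" "x \<in> X" "g x = h x"
    using that ex1[of x "h x"] permutes_in_image[OF perm, of h x] by auto
qed

lemma finite_regular_abelian: "finite X \<Longrightarrow> finite (regular_abelian X)"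
  by (rule finite_subset[of _ "Pow {p. p permutes X}"]) (auto simp: regular_abelian_def finite_permutations)

text \<open>Evaluation at a point identifies a regular group with the set it acts on.\<close>

lemma card_of_regular_abelian:
  assumes "G \<in> regular_abelian X" "x \<in> X"
  shows "card G = card X"
proof -
  have "bij_betw (\<lambda>g. g x) G X"
    unfolding bij_betw_def
  proof
    show "inj_on (\<lambda>g. g x) G"
      using regular_abelian_free[OF assms(1)] assms(2) by (auto intro: inj_onI)
    show "(\<lambda>g. g x) ` G = X"
    proof
      show "(\<lambda>g. g x) ` G \<subseteq> X"
        using permutes_in_image[OF regular_abelian_permutes[OF assms(1)]] assms(2) by auto
      show "X \<subseteq> (\<lambda>g. g x) ` G"
        using regular_abelian_transitive[OF assms] by blast
    qed
  qed
  then show ?thesis by (rule bij_betw_same_card)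
qed

text \<open>The points where g and h agree form a nonempty set stable under the tuple, because both
  maps commute with it; by transitivity this set is X.\<close>

lemma transitive_on_commuting_eq:
  assumes "transitive_on X ps" "x \<in> X" "g permutes X" "h permutes X" "g x = h x"
    and "\<forall>p\<in>set ps. p permutes X"
    and "\<forall>p\<in>set ps. g \<circ> p = p \<circ> g" "\<forall>p\<in>set ps. h \<circ> p = p \<circ> h"
  shows "g = h"
proof -
  let ?S = "{y \<in> X. g y = h y}"
  have "p ` ?S \<subseteq> ?S" if "p \<in> set ps" for p
  proof clarify
    fix y assume y: "y \<in> X" "g y = h y"
    have "g (p y) = p (g y)" "h (p y) = p (h y)" using assms(7,8) that by (metis comp_apply)+
    then show "p y \<in> X \<and> g (p y) = h (p y)" using y assms(6) that by (simp add: permutes_in_image)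
  qed
  then have "?S = X"
    using assms(2,5) by (intro transitive_onD[OF assms(1)]) auto
  show ?thesis
  proof
    fix y
    show "g y = h y"
      using \<open>?S = X\<close> permutes_not_in[OF assms(3), of y] permutes_not_in[OF assms(4), of y] by (cases "y \<in> X") auto
  qed
qed

text \<open>The group generated by a transitive commuting tuple is its double centralizer.\<close>
lemma ttuples_in_regular_abelian:
  assumes ps: "ps \<in> ttuples l X"
  shows "\<exists>G\<in>regular_abelian X. set ps \<subseteq> G"
proof -
  \<comment> \<open>\<open>D\<close> is the centralizer of the tuple among the permutations of X,
    and \<open>Z\<close> is the centralizer of \<open>D\<close>.\<close>
  define D where "D = {g. g permutes X \<and> (\<forall>p\<in>set ps. g \<circ> p = p \<circ> g)}"
  define Z where "Z = {g. g permutes X \<and> (\<forall>d\<in>D. g \<circ> d = d \<circ> g)}"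
  have tr: "transitive_on X ps" and perm: "\<forall>p\<in>set ps. p permutes X"
    and comm: "\<forall>p\<in>set ps. \<forall>q\<in>set ps. p \<circ> q = q \<circ> p"
    using ps by (auto simp: ttuples_def ctuples_def)
  have psD: "set ps \<subseteq> D" using perm comm by (auto simp: D_def)
  have psZ: "set ps \<subseteq> Z" using perm by (auto simp: Z_def D_def)
  \<comment> \<open>The entries lie in \<open>D\<close>, so \<open>Z\<close> commutes with them.
    From \<open>Z\<close> inside \<open>D\<close> it follows that \<open>Z\<close> is commutative
    and that its elements are determined by one value.\<close>
  have ZD: "Z \<subseteq> D" using psD by (auto simp: Z_def D_def)
  have "\<exists>g\<in>Z. g x = y" if "x \<in> X" "y \<in> X" for x y
  proof -
    \<comment> \<open>The \<open>Z\<close>-orbit of x is stable under the tuple since the entries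
      lie in \<open>Z\<close>, so it is all of X.\<close>
    let ?S = "(\<lambda>g. g x) ` Z"
    have "id \<in> Z" by (simp add: Z_def permutes_id)
    then have "?S \<noteq> {}" by auto
    moreover have "?S \<subseteq> X" using that by (auto simp: Z_def permutes_in_image)
    moreover have "p ` ?S \<subseteq> ?S" if p: "p \<in> set ps" for p
    proof clarify
      fix g assume g: "g \<in> Z"
      have "p \<in> Z" using p psZ by auto
      then have "p \<circ> g \<in> Z" using g unfolding Z_def
        by (auto intro: permutes_compose) (metis comp_assoc)
      then show "p (g x) \<in> ?S" by (metis comp_apply imageI)
    qed
    ultimately have "?S = X" by (intro transitive_onD[OF tr])
    then show ?thesis using that by (metis imageE)
  qed
  moreover have "g = h" if "g \<in> Z" "h \<in> Z" "x \<in> X" "g x = h x" for g h x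
    using that ZD perm tr by (intro transitive_on_commuting_eq[OF tr that(3)]) (auto simp: D_def)
  moreover have "\<forall>g\<in>Z. g permutes X" "\<forall>g\<in>Z. \<forall>h\<in>Z. g \<circ> h = h \<circ> g"
    using ZD by (auto simp: Z_def)
  ultimately have "Z \<in> regular_abelian X" unfolding regular_abelian_def by (simp, metis)
  then show ?thesis using psZ by blast
qed

text \<open>Elements of G and H with the same value at x both commute with the tuple and therefore
  coincide. Applied in both directions, this puts a transitive tuple in only one regular abelian
  group.\<close>

lemma regular_abelian_unique:
  assumes "transitive_on X ps" "x \<in> X"
    and "G \<in> regular_abelian X" "set ps \<subseteq> G" "H \<in> regular_abelian X" "set ps \<subseteq> H"
  shows "G \<subseteq> H"
proof
  fix g assume g: "g \<in> G"
  then have "g x \<in> X"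
    using permutes_in_image[OF regular_abelian_permutes[OF assms(3)]] assms(2) by simp
  then obtain h where h: "h \<in> H" "h x = g x" using regular_abelian_transitive[OF assms(5,2)] by blast
  have "h = g"
    by (rule transitive_on_commuting_eq[OF assms(1,2)])
      (use assms(4,6) g h regular_abelianD(1,2)[OF assms(3)] regular_abelianD(1,2)[OF assms(5)] in \<open>auto simp only: subset_iff\<close>)
  then show "g \<in> H" using h by simp
qed

section \<open>Counting transitive tuples inside a regular abelian group\<close>

lemma card_ttuples_eq_sum:
  assumes "finite X" "x \<in> X"
  shows "card (ttuples l X) = (\<Sum>G\<in>regular_abelian X. card {ps. set ps \<subseteq> G \<and> length ps = l \<and> transitive_on X ps})"
proof -
  let ?A = "\<lambda>G. {ps. set ps \<subseteq> G \<and> length ps = l \<and> transitive_on X ps}"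
  have "ttuples l X = (\<Union>G\<in>regular_abelian X. ?A G)"
  proof
    show "ttuples l X \<subseteq> (\<Union>G\<in>regular_abelian X. ?A G)"
      using ttuples_in_regular_abelian by (fastforce simp: ttuples_def ctuples_def)
    show "(\<Union>G\<in>regular_abelian X. ?A G) \<subseteq> ttuples l X"
    proof (rule UN_least, rule subsetI)
      fix G ps assume G: "G \<in> regular_abelian X" and ps: "ps \<in> ?A G"
      have "p \<in> G" if "p \<in> set ps" for p using that ps by auto
      then show "ps \<in> ttuples l X"
        using ps regular_abelian_permutes[OF G] regular_abelian_commute[OF G]
        by (simp add: ttuples_def ctuples_def)
    qed
  qed
  then have "card (ttuples l X) = card (\<Union>G\<in>regular_abelian X. ?A G)" by simp
  also have "\<dots> = (\<Sum>G\<in>regular_abelian X. card (?A G))"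
  proof (rule card_UN_disjoint)
    show "finite (regular_abelian X)" using assms by (simp add: finite_regular_abelian)
    have "finite G" if "G \<in> regular_abelian X" for G
      by (rule finite_subset[OF _ finite_permutations[OF assms(1)]]) (use that in \<open>auto simp: regular_abelian_def\<close>)
    then have "finite {ps. set ps \<subseteq> G \<and> length ps = l}" if "G \<in> regular_abelian X" for G
      using that finite_lists_length_eq by blast
    then show "\<forall>G\<in>regular_abelian X. finite (?A G)"
      by (auto intro: finite_subset[rotated])
    show "\<forall>G\<in>regular_abelian X. \<forall>H\<in>regular_abelian X. G \<noteq> H \<longrightarrow> ?A G \<inter> ?A H = {}"
      using regular_abelian_unique[OF _ assms(2)] by blast
  qed
  finally show ?thesis .
qed

text \<open>An element of G is determined by the image of s, which lies in S when S is
  stable.\<close>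

lemma card_stabilizer_regular_abelian_le:
  assumes "finite X" "G \<in> regular_abelian X" "S \<subseteq> X" "s \<in> S"
  shows "card {g\<in>G. g ` S \<subseteq> S} \<le> card S"
proof (rule card_inj_on_le)
  show "inj_on (\<lambda>g. g s) {g\<in>G. g ` S \<subseteq> S}"
    using regular_abelian_free[OF assms(2)] assms(3,4) by (auto intro!: inj_onI)
  show "(\<lambda>g. g s) ` {g\<in>G. g ` S \<subseteq> S} \<subseteq> S" using assms by auto
  show "finite S" using assms finite_subset by blast
qed

text \<open>An invariant set or its complement has at most \<open>card X / 2\<close> points, and this bounds the
  elements of \<open>G\<close> stabilising it.\<close>
lemma card_transitive_lists_bounds:
  assumes X: "finite X" "x \<in> X" and G: "G \<in> regular_abelian X"
  defines "k \<equiv> card X"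
  shows "real (card {ps. set ps \<subseteq> G \<and> length ps = l \<and> transitive_on X ps}) \<le> real k ^ l"
    and "real (card {ps. set ps \<subseteq> G \<and> length ps = l \<and> transitive_on X ps}) \<ge> real k ^ l - 2 ^ k * (real k / 2) ^ l"
proof -
  let ?L = "{ps. set ps \<subseteq> G \<and> length ps = l}"
  let ?A = "{ps. set ps \<subseteq> G \<and> length ps = l \<and> transitive_on X ps}"
  let ?I = "{S. S \<subseteq> X \<and> S \<noteq> {} \<and> 2 * card S \<le> k}"
  \<comment> \<open>Every intransitive list has all its entries in the stabilizer of some S in
    \<open>?I\<close>; at most \<open>(k/2) ^ l\<close> lists belong to each S, and there are at
    most \<open>2 ^ k\<close> sets S.\<close>
  let ?B = "\<lambda>S. {ps. set ps \<subseteq> {g\<in>G. g ` S \<subseteq> S} \<and> length ps = l}"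
  have perm: "g permutes X" if "g \<in> G" for g using that G by (auto simp: regular_abelian_def)
  have fG: "finite G" using perm by (intro finite_subset[OF _ finite_permutations[OF X(1)]]) auto
  have cL: "card ?L = k ^ l"
    using card_of_regular_abelian[OF G X(2)] card_lists_length_eq[OF fG, of l] by (simp add: k_def)
  have fL: "finite ?L" using fG by (rule finite_lists_length_eq)
  have "card ?A \<le> card ?L" by (rule card_mono[OF fL]) auto
  then show "real (card ?A) \<le> real k ^ l" using cL by (simp add: of_nat_power[symmetric] del: of_nat_power)
  have sub: "?L \<subseteq> ?A \<union> (\<Union>S\<in>?I. ?B S)"
  proof
    fix ps assume ps: "ps \<in> ?L"
    show "ps \<in> ?A \<union> (\<Union>S\<in>?I. ?B S)"
    proof (cases "transitive_on X ps")
      case True then show ?thesis using ps by auto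
    next
      case False
      then obtain S where S: "S \<subseteq> X" "S \<noteq> {}" "\<forall>p\<in>set ps. p ` S \<subseteq> S" "S \<noteq> X"
        unfolding transitive_on_def by blast
      have fS: "finite S" using S X finite_subset by blast
      have "\<forall>p\<in>set ps. p ` (X - S) \<subseteq> X - S"
        using permutes_invariant_diff[OF perm fS] S ps by blast
      moreover have "X - S \<noteq> {}" using S by auto
      moreover have "card (X - S) = k - card S" using S fS by (simp add: k_def card_Diff_subset)
      moreover have "2 * card S \<le> k \<or> 2 * (k - card S) \<le> k" by linarith
      ultimately obtain U where "U \<in> ?I" and U: "\<forall>p\<in>set ps. p ` U \<subseteq> U"
        using S by (metis (mono_tags, lifting) Diff_subset mem_Collect_eq)
      moreover have "ps \<in> ?B U" using U ps by (simp add: subset_iff)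
      ultimately show ?thesis by (intro UnI2 UN_I)
    qed
  qed
  have fB: "finite (?B S)" for S using fL by (rule finite_subset[rotated]) auto
  have fI: "finite ?I" using X by simp
  have B: "real (card (?B S)) \<le> (real k / 2) ^ l" if S: "S \<in> ?I" for S
  proof -
    obtain s where "s \<in> S" using S by auto
    then have "card {g\<in>G. g ` S \<subseteq> S} \<le> card S"
      using S by (intro card_stabilizer_regular_abelian_le[OF X(1) G]) auto
    then have "real (card {g\<in>G. g ` S \<subseteq> S}) \<le> real k / 2" using S by auto
    then show ?thesis using fG by (subst card_lists_length_eq) (auto intro: power_mono)
  qed
  have "card ?L \<le> card (?A \<union> (\<Union>S\<in>?I. ?B S))"
  proof (rule card_mono[OF _ sub])
    have "finite ?A" by (rule finite_subset[OF _ fL]) auto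
    then show "finite (?A \<union> (\<Union>S\<in>?I. ?B S))" using fI fB by (intro finite_UnI finite_UN_I)
  qed
  also have "\<dots> \<le> card ?A + (\<Sum>S\<in>?I. card (?B S))"
    by (rule order_trans[OF card_Un_le add_left_mono[OF card_UN_le[OF fI]]])
  finally have "real (card ?L) \<le> real (card ?A) + (\<Sum>S\<in>?I. real (card (?B S)))"
    by (simp only: of_nat_add[symmetric] of_nat_sum[symmetric] of_nat_le_iff)
  also have "(\<Sum>S\<in>?I. real (card (?B S))) \<le> real (card ?I) * (real k / 2) ^ l"
    by (rule sum_bounded_above) (rule B)
  also have "real (card ?I) * (real k / 2) ^ l \<le> 2 ^ k * (real k / 2) ^ l"
  proof (rule mult_right_mono)
    have "card ?I \<le> card (Pow X)" using X by (intro card_mono) auto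
    also have "\<dots> = 2 ^ k" using X by (simp add: card_Pow k_def)
    finally have "real (card ?I) \<le> real (2 ^ k)" by (simp only: of_nat_le_iff)
    then show "real (card ?I) \<le> 2 ^ k" by simp
  qed simp
  finally show "real (card ?A) \<ge> real k ^ l - 2 ^ k * (real k / 2) ^ l"
    using cL by (simp add: algebra_simps)
qed

lemma card_ttuples_bounds:
  assumes "finite X" "X \<noteq> {}"
  defines "k \<equiv> card X" and "r \<equiv> card (regular_abelian X)"
  shows "real (card (ttuples l X)) \<le> real r * real k ^ l"
    and "real (card (ttuples l X)) \<ge> real r * (real k ^ l - 2 ^ k * (real k / 2) ^ l)"
proof -
  obtain x where x: "x \<in> X" using assms by auto
  note b = card_transitive_lists_bounds[OF assms(1) x, folded k_def]
  show "real (card (ttuples l X)) \<le> real r * real k ^ l"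
    unfolding card_ttuples_eq_sum[OF assms(1) x] r_def of_nat_sum
    by (rule sum_bounded_above) (rule b)
  show "real (card (ttuples l X)) \<ge> real r * (real k ^ l - 2 ^ k * (real k / 2) ^ l)"
    unfolding card_ttuples_eq_sum[OF assms(1) x] r_def of_nat_sum
    by (rule sum_bounded_below) (rule b)
qed

subsection \<open>Regular abelian groups of degree at most four\<close>

text \<open>One-line notation for maps that fix everything from 4 on. Degrees 2 and 3 use it as
  well, with the last letters fixed.\<close>

definition word4 :: "nat \<Rightarrow> nat \<Rightarrow> nat \<Rightarrow> nat \<Rightarrow> nat \<Rightarrow> nat" where
  "word4 a b c d x = (if x = 0 then a else if x = 1 then b else if x = 2 then c else if x = 3 then d else x)"

lemma word4_simps [simp]:
  "word4 a b c d 0 = a" "word4 a b c d (Suc 0) = b" "word4 a b c d 2 = c" "word4 a b c d 3 = d"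
  by (simp_all add: word4_def)

lemma word4_eq_iff [simp]:
  "word4 a b c d = word4 a' b' c' d' \<longleftrightarrow> a = a' \<and> b = b' \<and> c = c' \<and> d = d'"
proof
  assume *: "word4 a b c d = word4 a' b' c' d'"
  show "a = a' \<and> b = b' \<and> c = c' \<and> d = d'"
    using fun_cong[OF *, of 0] fun_cong[OF *, of 1] fun_cong[OF *, of 2] fun_cong[OF *, of 3] by simp
qed simp

lemma less_4_cases: "(x::nat) < 4 \<longleftrightarrow> x = 0 \<or> x = 1 \<or> x = 2 \<or> x = 3"
  by auto

lemma word4_comp_word4:
  "word4 a' b' c' d' \<circ> word4 a b c d =
    word4 (word4 a' b' c' d' a) (word4 a' b' c' d' b) (word4 a' b' c' d' c) (word4 a' b' c' d' d)"
proof
  fix x :: nat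
  consider "x = 0" | "x = 1" | "x = 2" | "x = 3" | "x > 3" by linarith
  then show "(word4 a' b' c' d' \<circ> word4 a b c d) x =
    word4 (word4 a' b' c' d' a) (word4 a' b' c' d' b) (word4 a' b' c' d' c) (word4 a' b' c' d' d) x"
    by cases (simp_all, simp add: word4_def)
qed

lemma permutes_eq_word4:
  assumes "p permutes {..<k}" "k \<le> 4"
  shows "p = word4 (p 0) (p 1) (p 2) (p 3)"
proof
  fix x :: nat
  show "p x = word4 (p 0) (p 1) (p 2) (p 3) x"
    using permutes_not_in[OF assms(1), of x] assms(2) by (auto simp: word4_def)
qed

text \<open>These are the rows of a reduced Latin square: \<open>g i\<close> is the group element
  sending 0 to i, and distinct rows differ in every column.\<close>

definition translation_rows :: "nat \<Rightarrow> (nat \<Rightarrow> nat \<Rightarrow> nat) \<Rightarrow> bool" where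
  "translation_rows k g \<longleftrightarrow> g 0 = id \<and> (\<forall>i<k. g i permutes {..<k} \<and> g i 0 = i) \<and>
     (\<forall>i<k. \<forall>j<k. \<forall>x<k. i \<noteq> j \<longrightarrow> g i x \<noteq> g j x)"

lemma translation_rowsD:
  assumes "translation_rows k g"
  shows "g 0 = id" and "i < k \<Longrightarrow> g i permutes {..<k}" and "i < k \<Longrightarrow> g i 0 = i"
    and "i < k \<Longrightarrow> j < k \<Longrightarrow> x < k \<Longrightarrow> i \<noteq> j \<Longrightarrow> g i x \<noteq> g j x"
    and "i < k \<Longrightarrow> inj (g i)" and "i < k \<Longrightarrow> x < k \<Longrightarrow> g i x < k"
  using assms permutes_inj[of "g i" "{..<k}"] permutes_in_image[of "g i" "{..<k}" x]
  by (auto simp: translation_rows_def)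

lemma regular_abelian_obtain_rows:
  assumes "G \<in> regular_abelian {..<k}" "k > 0"
  obtains g where "translation_rows k g" "G = g ` {..<k}"
proof -
  have "\<exists>h\<in>G. h 0 = i" if "i < k" for i
    using that assms(2) by (intro regular_abelian_transitive[OF assms(1)]) auto
  then obtain g where g: "\<And>i. i < k \<Longrightarrow> g i \<in> G \<and> g i 0 = i" by metis
  have perm: "h permutes {..<k}" if "h \<in> G" for h using that by (rule regular_abelian_permutes[OF assms(1)])
  have G: "G = g ` {..<k}"
  proof
    show "G \<subseteq> g ` {..<k}"
    proof
      fix h assume h: "h \<in> G"
      then have "h 0 < k" using permutes_in_image[OF perm, of h 0] assms(2) by simp
      then have "h = g (h 0)" using h g assms(2) by (intro regular_abelian_free[OF assms(1), of h _ 0]) auto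
      then show "h \<in> g ` {..<k}" using \<open>h 0 < k\<close> by blast
    qed
  qed (use g in auto)
  \<comment> \<open>The identity is not postulated in \<open>regular_abelian\<close>. An element
    fixing 0 fixes every h 0, because it commutes with h.\<close>
  have fix0: "g 0 x = x" if "x < k" for x
  proof -
    have "\<exists>h\<in>G. h 0 = x" using that assms(2) by (intro regular_abelian_transitive[OF assms(1)]) auto
    then obtain h where h: "h \<in> G" "h 0 = x" by blast
    have "g 0 (h 0) = h (g 0 0)"
      using regular_abelian_commute[OF assms(1), of "g 0" h] g[of 0] h(1) by (metis comp_apply assms(2))
    then show ?thesis using h g[of 0] assms(2) by simp
  qed
  have "g 0 = id"
  proof
    fix x
    show "g 0 x = id x"
      using fix0[of x] permutes_not_in[OF perm, of "g 0" x] g[of 0] assms(2) by (cases "x < k") auto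
  qed
  moreover have "g i x \<noteq> g j x" if "i < k" "j < k" "x < k" "i \<noteq> j" for i j x
    using regular_abelian_free[OF assms(1), of "g i" "g j" x] g that by (metis lessThan_iff)
  ultimately have "translation_rows k g" using g perm by (simp add: translation_rows_def)
  then show ?thesis using that G by blast
qed

lemma id_eq_word4: "id = word4 0 1 2 3"
  by (auto simp: word4_def fun_eq_iff)

lemma word4_permutes:
  assumes "distinct [a, b, c, d]" "a < 4" "b < 4" "c < 4" "d < 4"
  shows "word4 a b c d permutes {..<4}"
proof (rule bij_imp_permutes)
  have 4: "{..<4::nat} = {0, 1, 2, 3}" by auto
  have "inj_on (word4 a b c d) {..<4}" unfolding 4 using assms(1) by (simp add: inj_on_def)
  moreover have "word4 a b c d ` {..<4} \<subseteq> {..<4}" using assms(2-) by (auto simp: word4_def)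
  ultimately show "bij_betw (word4 a b c d) {..<4} {..<4}"
    by (simp add: bij_betw_def endo_inj_surj)
qed (simp add: word4_def)

text \<open>With as many elements as points, injectivity of an evaluation map already yields its
  surjectivity.\<close>

lemma regular_abelianI:
  assumes "finite X" "card G = card X" "\<forall>g\<in>G. g permutes X" "\<forall>g\<in>G. \<forall>h\<in>G. g \<circ> h = h \<circ> g"
    and inj: "\<forall>x\<in>X. inj_on (\<lambda>g. g x) G"
  shows "G \<in> regular_abelian X"
proof -
  have "\<exists>!g. g \<in> G \<and> g x = y" if "x \<in> X" "y \<in> X" for x y
  proof -
    have "(\<lambda>g. g x) ` G \<subseteq> X" using assms(3) that by (auto simp: permutes_in_image)
    moreover have "card ((\<lambda>g. g x) ` G) = card X" using inj that assms(2) by (simp add: card_image)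
    ultimately have "(\<lambda>g. g x) ` G = X" using assms(1) by (intro card_subset_eq)
    then have "y \<in> (\<lambda>g. g x) ` G" using that by simp
    then obtain g where "g \<in> G" "g x = y" by blast
    moreover have "h = g" if "h \<in> G" "h x = y" for h
      using inj_onD[OF inj[rule_format, OF \<open>x \<in> X\<close>]] that calculation by simp
    ultimately show ?thesis by blast
  qed
  then show ?thesis using assms(3,4) by (simp add: regular_abelian_def)
qed

text \<open>The first choice of letters is the Klein four-group, the other three are cyclic groups,
  told apart by their element of order two.\<close>

lemma word4_regular_abelian4:
  assumes G: "G = {word4 0 1 2 3, word4 1 b1 c1 d1, word4 2 b2 c2 d2, word4 3 b3 c3 d3}"
    and "(b1, c1, d1, b2, c2, d2, b3, c3, d3) \<in>
      {(0,3,2,3,0,1,2,1,0), (0,3,2,3,1,0,2,0,1), (2,3,0,3,0,1,0,1,2), (3,0,2,0,3,1,2,1,0)}"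
  shows "G \<in> regular_abelian {..<4}"
proof (rule regular_abelianI)
  have 4: "{..<4::nat} = {0, 1, 2, 3}" by auto
  show "finite {..<4::nat}" by simp
  show "card G = card {..<4::nat}" by (simp add: G)
  show "\<forall>g\<in>G. g permutes {..<4}"
    using assms(2) unfolding G by (elim insertE emptyE) (simp_all add: word4_permutes)
  show "\<forall>g\<in>G. \<forall>h\<in>G. g \<circ> h = h \<circ> g"
    using assms(2) unfolding G by (elim insertE emptyE) (simp_all add: word4_comp_word4)
  show "\<forall>x\<in>{..<4}. inj_on (\<lambda>g. g x) G"
    using assms(2) unfolding G 4 by (elim insertE emptyE) (simp_all add: inj_on_def)
qed

text \<open>A row other than row 0 moves every point. The nine derangements of four points fall into
  three for each value at 0.\<close>

lemma derangement4:
  fixes a b c :: nat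
  assumes "a < 4" "b < 4" "c < 4" "a \<noteq> 1" "b \<noteq> 2" "c \<noteq> 3"
  shows "distinct [1, a, b, c] \<Longrightarrow> (a, b, c) \<in> {(0,3,2), (2,3,0), (3,0,2)}"
    "distinct [2, a, b, c] \<Longrightarrow> (a, b, c) \<in> {(3,0,1), (3,1,0), (0,3,1)}"
    "distinct [3, a, b, c] \<Longrightarrow> (a, b, c) \<in> {(2,1,0), (2,0,1), (0,1,2)}"
  using assms unfolding less_4_cases by (elim disjE; simp)+

text \<open>Three candidates for each of three rows leave 27 combinations; exactly four have no two
  rows agreeing in a column, and each of them is a regular abelian group.\<close>

lemma regular_abelian_4:
  "regular_abelian {..<4} =
    {{word4 0 1 2 3, word4 1 0 3 2, word4 2 3 0 1, word4 3 2 1 0},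
     {word4 0 1 2 3, word4 1 0 3 2, word4 2 3 1 0, word4 3 2 0 1},
     {word4 0 1 2 3, word4 1 2 3 0, word4 2 3 0 1, word4 3 0 1 2},
     {word4 0 1 2 3, word4 1 3 0 2, word4 2 0 3 1, word4 3 2 1 0}}" (is "_ = ?R")
proof (intro set_eqI iffI)
  fix G assume "G \<in> regular_abelian {..<4}"
  then obtain g where rows: "translation_rows 4 g" and G: "G = g ` {..<4}"
    by (rule regular_abelian_obtain_rows) simp
  note id = translation_rowsD(1)[OF rows] and perm = translation_rowsD(2)[OF rows] and g0 = translation_rowsD(3)[OF rows]
    and ne = translation_rowsD(4)[OF rows] and inj = translation_rowsD(5)[OF rows] and lt = translation_rowsD(6)[OF rows]
  have w: "g i = word4 i (g i 1) (g i 2) (g i 3)" if "i < 4" for i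
    using permutes_eq_word4[OF perm[OF that]] g0[OF that] by simp
  have ne0: "g i x \<noteq> x" if "i < 4" "x < 4" "i \<noteq> 0" for i x
    using ne[of i 0 x] that id by simp
  have ds: "distinct [i, g i 1, g i 2, g i 3]" if "i < 4" for i
  proof -
    have "distinct (map (g i) [0, 1, 2, 3])"
      using inj[OF that] by (simp add: inj_eq)
    then show ?thesis using g0[OF that] by simp
  qed
  have row: "(g 1 1, g 1 2, g 1 3) \<in> {(0,3,2), (2,3,0), (3,0,2)}"
    "(g 2 1, g 2 2, g 2 3) \<in> {(3,0,1), (3,1,0), (0,3,1)}"
    "(g 3 1, g 3 2, g 3 3) \<in> {(2,1,0), (2,0,1), (0,1,2)}"
    using derangement4[of "g 1 1" "g 1 2" "g 1 3"] derangement4[of "g 2 1" "g 2 2" "g 2 3"]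
      derangement4[of "g 3 1" "g 3 2" "g 3 3"] ds[of 1] ds[of 2] ds[of 3]
      lt[of 1] lt[of 2] lt[of 3] ne0[of 1] ne0[of 2] ne0[of 3] by simp_all
  have "{..<4} = {0, 1, 2, 3::nat}" by auto
  then have G': "G = {g 0, g 1, g 2, g 3}" unfolding G by simp
  have rows: "g 1 \<in> {word4 1 0 3 2, word4 1 2 3 0, word4 1 3 0 2}"
    "g 2 \<in> {word4 2 3 0 1, word4 2 3 1 0, word4 2 0 3 1}"
    "g 3 \<in> {word4 3 2 1 0, word4 3 2 0 1, word4 3 0 1 2}"
    using row w[of 1] w[of 2] w[of 3] by auto
  have cols: "g 1 x \<noteq> g 2 x" "g 1 x \<noteq> g 3 x" "g 2 x \<noteq> g 3 x" if "x < 4" for x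
    using that ne by simp_all
  show "G \<in> ?R"
    using rows cols[of 1] cols[of 2] cols[of 3] unfolding G' id id_eq_word4
    by (elim insertE emptyE) simp_all
next
  fix G assume "G \<in> ?R"
  then show "G \<in> regular_abelian {..<4}"
    by (elim insertE emptyE) (rule word4_regular_abelian4, assumption, simp)+
qed

lemma card_regular_abelian_4: "card (regular_abelian {..<4}) = 4"
proof -
  \<comment> \<open>The four groups are separated by exhibiting an element that lies in only one of
    the two.\<close>
  have "A \<noteq> B" if "x \<in> A" "x \<notin> B" for A B and x :: "nat \<Rightarrow> nat" using that by auto
  note ne = this
  show ?thesis unfolding regular_abelian_4
    by (simp add: ne[of "word4 2 3 0 1"] ne[of "word4 2 3 1 0"] ne[of "word4 1 2 3 0"] ne[of "word4 1 0 3 2"])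
qed

lemma card_regular_abelian_1: "card (regular_abelian {..<1}) = 1"
proof -
  have "regular_abelian {..<1} = {{id}}"
  proof (intro set_eqI iffI)
    fix G assume "G \<in> regular_abelian {..<1}"
    then obtain g where "translation_rows 1 g" "G = g ` {..<1}"
      by (rule regular_abelian_obtain_rows) simp
    moreover have "{..<1::nat} = {0}" by auto
    ultimately show "G \<in> {{id}}" using translation_rowsD(1)[of 1 g] by (simp only: image_insert image_empty singleton_iff)
  next
    fix G :: "(nat \<Rightarrow> nat) set" assume "G \<in> {{id}}"
    then show "G \<in> regular_abelian {..<1}" by (intro regular_abelianI) (auto intro: permutes_id)
  qed
  then show ?thesis by simp
qed

lemma card_regular_abelian_2: "card (regular_abelian {..<2}) = 1"
proof -
  have 2: "{..<2::nat} = {0, 1}" by auto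
  have p: "word4 1 0 2 3 permutes {..<2}"
    by (rule permutes_superset[of _ "{..<4}"]) (auto intro!: word4_permutes simp: word4_def)
  have "regular_abelian {..<2} = {{word4 0 1 2 3, word4 1 0 2 3}}"
  proof (intro set_eqI iffI)
    fix G assume "G \<in> regular_abelian {..<2}"
    then obtain g where rows: "translation_rows 2 g" and G: "G = g ` {..<2}"
      by (rule regular_abelian_obtain_rows) simp
    note id = translation_rowsD(1)[OF rows] and perm = translation_rowsD(2)[OF rows] and g0 = translation_rowsD(3)[OF rows]
      and ne = translation_rowsD(4)[OF rows] and inj = translation_rowsD(5)[OF rows] and lt = translation_rowsD(6)[OF rows]
    have "g 1 1 = 0" using lt[of 1 1] ne[of 1 0 1] id by simp
    moreover have "g 1 2 = 2" "g 1 3 = 3" using permutes_not_in[OF perm[of 1]] by simp_all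
    ultimately have "g 1 = word4 1 0 2 3" using permutes_eq_word4[OF perm[of 1]] g0[of 1] by simp
    moreover have "{..<2} = {0, 1::nat}" by auto
    then have "G = {g 0, g 1}" unfolding G by simp
    ultimately show "G \<in> {{word4 0 1 2 3, word4 1 0 2 3}}" by (simp add: id id_eq_word4)
  next
    fix G assume "G \<in> {{word4 0 1 2 3, word4 1 0 2 3}}"
    then have G: "G = {id, word4 1 0 2 3}" by (simp add: id_eq_word4)
    have "id \<noteq> word4 1 0 2 3" by (simp add: id_eq_word4)
    then show "G \<in> regular_abelian {..<2}"
      using p by (intro regular_abelianI) (simp_all add: G permutes_id, simp add: 2)
  qed
  then show ?thesis by simp
qed

lemma card_regular_abelian_3: "card (regular_abelian {..<3}) = 1"
proof -
  have 3: "{..<3::nat} = {0, 1, 2}" by auto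
  have p: "word4 1 2 0 3 permutes {..<3}" "word4 2 0 1 3 permutes {..<3}"
    by (rule permutes_superset[of _ "{..<4}"]; auto intro!: word4_permutes simp: word4_def)+
  have "regular_abelian {..<3} = {{word4 0 1 2 3, word4 1 2 0 3, word4 2 0 1 3}}"
  proof (intro set_eqI iffI)
    fix G assume "G \<in> regular_abelian {..<3}"
    then obtain g where rows: "translation_rows 3 g" and G: "G = g ` {..<3}"
      by (rule regular_abelian_obtain_rows) simp
    note id = translation_rowsD(1)[OF rows] and perm = translation_rowsD(2)[OF rows] and g0 = translation_rowsD(3)[OF rows]
      and ne = translation_rowsD(4)[OF rows] and inj = translation_rowsD(5)[OF rows] and lt = translation_rowsD(6)[OF rows]
    have d: "g i 1 \<noteq> i" "g i 2 \<noteq> i" "g i 1 \<noteq> g i 2" if "i < 3" for i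
      using g0[OF that] inj_eq[OF inj[OF that], of _ 0] inj_eq[OF inj[OF that], of 1 2] by auto
    have "g 1 1 = 2" "g 1 2 = 0" "g 2 2 = 1" "g 2 1 = 0"
      using lt[of 1 1] lt[of 1 2] lt[of 2 1] lt[of 2 2] ne[of 1 0 1] ne[of 1 0 2] ne[of 2 0 1] ne[of 2 0 2]
        d[of 1] d[of 2] id by simp_all
    moreover have "g 1 3 = 3" "g 2 3 = 3"
      using permutes_not_in[OF perm[of 1]] permutes_not_in[OF perm[of 2]] by simp_all
    ultimately have "g 1 = word4 1 2 0 3" "g 2 = word4 2 0 1 3"
      using permutes_eq_word4[OF perm[of 1]] g0[of 1] permutes_eq_word4[OF perm[of 2]] g0[of 2] by simp_all
    moreover have "{..<3} = {0, 1, 2::nat}" by auto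
    then have "G = {g 0, g 1, g 2}" unfolding G by simp
    ultimately show "G \<in> {{word4 0 1 2 3, word4 1 2 0 3, word4 2 0 1 3}}" by (simp add: id id_eq_word4)
  next
    fix G assume "G \<in> {{word4 0 1 2 3, word4 1 2 0 3, word4 2 0 1 3}}"
    then have G: "G = {word4 0 1 2 3, word4 1 2 0 3, word4 2 0 1 3}" by simp
    have "word4 0 1 2 3 permutes {..<3}" unfolding id_eq_word4[symmetric] by (rule permutes_id)
    then show "G \<in> regular_abelian {..<3}"
      using p by (intro regular_abelianI) (simp_all add: G word4_comp_word4, simp add: 3)
  qed
  then show ?thesis by simp
qed

subsection \<open>Two-term expansions\<close>

text \<open>The second order is needed because at \<open>n = 20\<close> the leading terms of Delta cancel; the base \<open>8/9\<close>
  is the largest ratio below 1 that occurs.\<close>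
definition expands :: "(nat \<Rightarrow> real) \<Rightarrow> real \<Rightarrow> real \<Rightarrow> bool" where
  "expands f c d \<longleftrightarrow> (\<lambda>l. (f l - c) * (9/8) ^ l) \<longlonglongrightarrow> d"

lemma expands_const: "expands (\<lambda>_. c) c 0"
  by (simp add: expands_def)

lemma expands_add:
  assumes "expands f c d" "expands g c' d'"
  shows "expands (\<lambda>l. f l + g l) (c + c') (d + d')"
  using tendsto_add[OF assms[unfolded expands_def]] unfolding expands_def
  by (rule Lim_transform_eventually) (simp add: algebra_simps)

lemma expands_cmult:
  assumes "expands f c d"
  shows "expands (\<lambda>l. a * f l) (a * c) (a * d)"
  using tendsto_mult_left[OF assms[unfolded expands_def], of a] unfolding expands_def
  by (rule Lim_transform_eventually) (simp add: algebra_simps)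

lemma expands_sum:
  assumes "finite A" "\<And>k. k \<in> A \<Longrightarrow> expands (f k) (c k) (d k)"
  shows "expands (\<lambda>l. \<Sum>k\<in>A. f k l) (\<Sum>k\<in>A. c k) (\<Sum>k\<in>A. d k)"
  using assms by (induction A rule: finite_induct) (auto intro: expands_const expands_add)

lemma expands_tendsto:
  assumes "expands f c d"
  shows "f \<longlonglongrightarrow> c"
proof -
  have "(\<lambda>l. (8/9::real) ^ l) \<longlonglongrightarrow> 0" by (rule LIMSEQ_power_zero) simp
  from tendsto_mult[OF assms[unfolded expands_def] this]
  have "(\<lambda>l. (f l - c) * (9/8) ^ l * (8/9) ^ l) \<longlonglongrightarrow> 0" by simp
  moreover have "(f l - c) * (9/8) ^ l * (8/9) ^ l = f l - c" for l
    by (simp add: mult.assoc flip: power_mult_distrib)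
  ultimately have "(\<lambda>l. f l - c) \<longlonglongrightarrow> 0" by simp
  then show ?thesis by (simp add: LIM_zero_iff)
qed

text \<open>The product rule, from f g - c c' = (f - c) g + c (g - c').\<close>

lemma expands_mult:
  assumes "expands f c d" "expands g c' d'"
  shows "expands (\<lambda>l. f l * g l) (c * c') (d * c' + c * d')"
proof -
  have "(\<lambda>l. (f l - c) * (9/8) ^ l * g l + c * ((g l - c') * (9/8) ^ l)) \<longlonglongrightarrow> d * c' + c * d'"
    using assms expands_tendsto[OF assms(2)] unfolding expands_def
    by (intro tendsto_add tendsto_mult tendsto_const)
  then show ?thesis unfolding expands_def
    by (rule Lim_transform_eventually) (simp add: algebra_simps)
qed

text \<open>A base below 8/9 is invisible at both orders, since r * 9/8 < 1.\<close>

lemma expands_geometric_small: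
  assumes "f \<longlonglongrightarrow> c" "0 \<le> r" "r < 8/9"
  shows "expands (\<lambda>l. r ^ l * f l) 0 0"
proof -
  have "(\<lambda>l. (r * (9/8)) ^ l) \<longlonglongrightarrow> 0" using assms by (intro LIMSEQ_power_zero) auto
  from tendsto_mult[OF this assms(1)] have "(\<lambda>l. (r * (9/8)) ^ l * f l) \<longlonglongrightarrow> 0" by simp
  moreover have "(r ^ l * f l - 0) * (9/8) ^ l = (r * (9/8)) ^ l * f l" for l
    by (simp only: power_mult_distrib diff_0_right mult_ac)
  ultimately show ?thesis by (simp only: expands_def)
qed

text \<open>A base of exactly 8/9 moves the leading coefficient to second order.\<close>

lemma expands_geometric_critical:
  assumes "f \<longlonglongrightarrow> c"
  shows "expands (\<lambda>l. (8/9) ^ l * f l) 0 c"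
proof -
  have "((8/9) ^ l * f l - 0) * (9/8) ^ l = ((8/9) * (9/8)) ^ l * f l" for l
    by (simp only: power_mult_distrib diff_0_right mult_ac)
  then have "((8/9) ^ l * f l - 0) * (9/8) ^ l = f l" for l by simp
  then show ?thesis using assms by (simp only: expands_def)
qed

text \<open>The limit of the orbit factor t(k) / (k - 1)! after division by
  \<open>k ^ l\<close>.\<close>

definition tau :: "nat \<Rightarrow> real" where
  "tau k = real (card (regular_abelian {..<k})) / fact (k - 1)"

lemma tau_simps: "tau 1 = 1" "tau 2 = 1" "tau 3 = 1/2" "tau 4 = 2/3"
  by (simp_all add: tau_def card_regular_abelian_1[simplified] card_regular_abelian_2
      card_regular_abelian_3 card_regular_abelian_4 fact_numeral)

text \<open>The relative error in \<open>card_ttuples_bounds\<close> is a constant times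
  \<open>(1/2) ^ l\<close>. As 1/2 * 9/8 = 9/16 < 1, nothing of it survives at second order.\<close>

lemma expands_ttuples:
  assumes "k \<ge> 1"
  shows "expands (\<lambda>l. real (card (ttuples l {..<k})) / (fact (k - 1) * real k ^ l)) (tau k) 0"
proof -
  define r where "r = real (card (regular_abelian {..<k}))"
  let ?t = "\<lambda>l. real (card (ttuples l {..<k}))"
  have "(\<lambda>l. r * 2 ^ k * (9/16) ^ l / fact (k - 1)) \<longlonglongrightarrow> r * 2 ^ k * 0 / fact (k - 1)"
    by (intro tendsto_intros LIMSEQ_power_zero) auto
  then have lim: "(\<lambda>l. r * 2 ^ k * (9/16) ^ l / fact (k - 1)) \<longlonglongrightarrow> 0" by simp
  have "\<bar>(?t l / (fact (k - 1) * real k ^ l) - tau k) * (9/8) ^ l\<bar> \<le> r * 2 ^ k * (9/16) ^ l / fact (k - 1)" for l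
  proof -
    have k: "real k ^ l > 0" using assms by simp
    have ne: "{..<k} \<noteq> {}" using assms by (auto simp: lessThan_empty_iff)
    have u: "?t l \<le> r * real k ^ l" "?t l \<ge> r * (real k ^ l - 2 ^ k * (real k / 2) ^ l)"
      using card_ttuples_bounds[of "{..<k}" l] ne by (simp_all add: r_def)
    have "?t l / real k ^ l \<le> r" using u(1) k by (simp add: field_simps)
    moreover have "r - r * 2 ^ k * (1/2) ^ l \<le> ?t l / real k ^ l"
      using u(2) k by (simp add: field_simps power_divide)
    ultimately have "\<bar>?t l / real k ^ l - r\<bar> \<le> r * 2 ^ k * (1/2) ^ l" by linarith
    then have "\<bar>?t l / real k ^ l - r\<bar> * ((9/8) ^ l / fact (k - 1)) \<le> r * 2 ^ k * (1/2) ^ l * ((9/8) ^ l / fact (k - 1))"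
      by (intro mult_right_mono) auto
    also have "\<dots> = r * 2 ^ k * (9/16) ^ l / fact (k - 1)"
      by (simp add: mult.assoc flip: power_mult_distrib)
    also have "\<bar>?t l / real k ^ l - r\<bar> * ((9/8) ^ l / fact (k - 1)) =
      \<bar>(?t l / (fact (k - 1) * real k ^ l) - tau k) * (9/8) ^ l\<bar>"
    proof -
      have "?t l / (fact (k - 1) * real k ^ l) - tau k = (?t l / real k ^ l - r) / fact (k - 1)"
        by (simp add: tau_def r_def diff_divide_distrib mult.commute)
      then show ?thesis by (simp add: abs_mult)
    qed
    finally show ?thesis .
  qed
  then have "norm ((?t l / (fact (k - 1) * real k ^ l) - tau k) * (9/8) ^ l) \<le> norm (r * 2 ^ k * (9/16) ^ l / fact (k - 1)) * 1" for l
    unfolding real_norm_def mult_1_right by (rule order_trans[OF _ abs_ge_self])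
  then show ?thesis unfolding expands_def
    by (rule tendsto_0_le[OF lim always_eventually[OF allI]])
qed

subsection \<open>The maximal order of an abelian permutation group\<close>

text \<open>Adding three points multiplies the value by 3 only from argument 2 on:
  \<open>max_order 4\<close> is 4, which exceeds 3 * \<open>max_order 1\<close>.\<close>

fun max_order :: "nat \<Rightarrow> real" where
  "max_order 0 = 1"
| "max_order (Suc 0) = 1"
| "max_order (Suc (Suc 0)) = 2"
| "max_order (Suc (Suc (Suc 0))) = 3"
| "max_order (Suc (Suc (Suc (Suc 0)))) = 4"
| "max_order (Suc (Suc (Suc (Suc (Suc n))))) = 3 * max_order (Suc (Suc n))"

lemma max_order_pos: "max_order n > 0"
  by (induction n rule: max_order.induct) auto

lemma max_order_add2: "2 * max_order n \<le> max_order (Suc (Suc n))"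
proof (induction n rule: max_order.induct)
  case (6 n)
  then show ?case by (cases n) auto
qed simp_all

lemma max_order_add3: "3 * max_order n \<le> max_order (n + 3)"
  by (cases n rule: max_order.cases) (simp_all add: numeral_3_eq_3)

text \<open>Breaking k points into parts 2 and 3 beats a single orbit of size k. The tight case is k
  = 5, where 2 * 3 = 6 = 5 * 6/5.\<close>

lemma max_order_add_ge5:
  "5 \<le> k \<Longrightarrow> real k * 6 / 5 * max_order n \<le> max_order (n + k)"
proof (induction k rule: less_induct)
  case (less k)
  note 2 = max_order_add2[of n] max_order_add2[of "Suc (Suc n)"]
  note p = max_order_pos[of n]
  \<comment> \<open>The parts 2 + 3, 3 + 3 and 2 + 2 + 3 give the factors 6, 9 and 12. From 8 on one
    part 3 is removed, using 3 (k - 3) \<ge> k.\<close>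
  consider "k = 5" | "k = 6" | "k = 7" | "k \<ge> 8" using less.prems by linarith
  then show ?case
  proof cases
    case 1
    then show ?thesis using 2 max_order_add3[of "n + 2"] by (simp add: eval_nat_numeral)
  next
    case 2
    then show ?thesis using p max_order_add3[of n] max_order_add3[of "n + 3"] by (simp add: eval_nat_numeral)
  next
    case 3
    then show ?thesis using p 2 max_order_add3[of "n + 4"] by (simp add: eval_nat_numeral)
  next
    case 4
    then have "real (k - 3) * 6 / 5 * max_order n \<le> max_order (n + (k - 3))" by (intro less.IH) auto
    moreover have "3 * max_order (n + (k - 3)) \<le> max_order (n + k)"
      using max_order_add3[of "n + (k - 3)"] 4 by (simp add: add.assoc)
    moreover have "real k * 6 / 5 * max_order n \<le> 3 * (real (k - 3) * 6 / 5 * max_order n)"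
      using p 4 by (simp add: of_nat_diff field_simps)
    ultimately show ?thesis by linarith
  qed
qed

lemma max_order_closed:
  "max_order (3 * j) = 3 ^ j" "max_order (3 * j + 2) = 2 * 3 ^ j" "max_order (3 * j + 4) = 4 * 3 ^ j"
proof -
  have step: "max_order (n + 5) = 3 * max_order (n + 2)" for n by (simp add: eval_nat_numeral)
  have step4: "max_order (n + 7) = 3 * max_order (n + 4)" for n by (simp add: eval_nat_numeral)
  show "max_order (3 * j + 2) = 2 * 3 ^ j"
  proof (induction j)
    case (Suc j)
    then show ?case using step[of "3 * j"] by (simp add: algebra_simps)
  qed (simp add: eval_nat_numeral)
  show "max_order (3 * j + 4) = 4 * 3 ^ j"
  proof (induction j)
    case (Suc j)
    then show ?case using step4[of "3 * j"] by (simp add: algebra_simps)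
  qed (simp add: eval_nat_numeral)
  show "max_order (3 * j) = 3 ^ j"
  proof (induction j)
    case (Suc j)
    \<comment> \<open>Subtraction truncates at j = 0, so that case is split off and evaluated
      directly.\<close>
    then show ?case using step[of "3 * j - 2"] by (cases j) (simp_all add: algebra_simps eval_nat_numeral)
  qed simp
qed

section \<open>The normalized recurrence\<close>

definition normalized :: "nat \<Rightarrow> nat \<Rightarrow> real" where
  "normalized n l = N l n / max_order n ^ l"

text \<open>Each summand is written as the l-th power of a fixed base times a factor that converges,
  so that its size is governed by the base alone.\<close>

lemma normalized_rec:
  assumes "n \<ge> 1"
  shows "normalized n l = 1 / real n * (\<Sum>k=1..n. (real k * max_order (n - k) / max_order n) ^ l *
    (real (card (ttuples l {..<k})) / (fact (k - 1) * real k ^ l) * normalized (n - k) l))"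
proof -
  obtain n' where n: "n = Suc n'" using assms by (cases n) auto
  have "real n * N l n = (\<Sum>k=1..n. real (card (ttuples l {..<k})) / fact (k - 1) * N l (n - k))"
    unfolding n N_Suc One_nat_def sum.shift_bounds_cl_Suc_ivl atLeast0AtMost by simp
  moreover have "normalized n l = 1 / real n * (real n * N l n / max_order n ^ l)"
    using assms by (simp add: normalized_def)
  ultimately have "normalized n l = 1 / real n * (\<Sum>k=1..n. real (card (ttuples l {..<k})) / fact (k - 1) * N l (n - k) / max_order n ^ l)"
    by (simp only: sum_divide_distrib)
  also have "(\<Sum>k=1..n. real (card (ttuples l {..<k})) / fact (k - 1) * N l (n - k) / max_order n ^ l) =
    (\<Sum>k=1..n. (real k * max_order (n - k) / max_order n) ^ l *
    (real (card (ttuples l {..<k})) / (fact (k - 1) * real k ^ l) * normalized (n - k) l))"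
  proof (rule sum.cong[OF refl])
    fix k assume "k \<in> {1..n}"
    then have "k \<noteq> 0" "max_order (n - k) \<noteq> 0" "max_order n \<noteq> 0"
      using max_order_pos[of n] max_order_pos[of "n - k"] by auto
    then show "real (card (ttuples l {..<k})) / fact (k - 1) * N l (n - k) / max_order n ^ l =
      (real k * max_order (n - k) / max_order n) ^ l *
      (real (card (ttuples l {..<k})) / (fact (k - 1) * real k ^ l) * normalized (n - k) l)"
      unfolding normalized_def power_mult_distrib power_divide by (simp add: field_simps)
  qed
  finally show ?thesis .
qed

text \<open>Orbits of size at least 5 are negligible: they cost a factor of at least \<open>6/5\<close> in the base.\<close>
lemma expands_normalized_step:
  assumes n: "n \<ge> 1" and IH: "\<And>m. m < n \<Longrightarrow> expands (normalized m) (c m) (d m)"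
    and ratio: "\<And>k. 1 \<le> k \<Longrightarrow> k \<le> 4 \<Longrightarrow> k \<le> n \<Longrightarrow>
      (real k * max_order (n - k) = max_order n \<and> C k = tau k * c (n - k) \<and> D k = tau k * d (n - k)) \<or>
      (9 * (real k * max_order (n - k)) = 8 * max_order n \<and> C k = 0 \<and> D k = tau k * c (n - k)) \<or>
      (9 * (real k * max_order (n - k)) < 8 * max_order n \<and> C k = 0 \<and> D k = 0)"
  shows "expands (normalized n) ((\<Sum>k=1..min 4 n. C k) / n) ((\<Sum>k=1..min 4 n. D k) / n)"
proof -
  \<comment> \<open>Orbits of more than four points get coefficient 0, so the sums up to n later
    shrink to sums up to \<open>min 4 n\<close>.\<close>
  let ?C = "\<lambda>k. if k \<le> 4 then C k else 0" and ?D = "\<lambda>k. if k \<le> 4 then D k else 0"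
  let ?r = "\<lambda>k. real k * max_order (n - k) / max_order n"
  let ?g = "\<lambda>k l. real (card (ttuples l {..<k})) / (fact (k - 1) * real k ^ l) * normalized (n - k) l"
  have pos: "max_order m > 0" for m by (rule max_order_pos)
  have "expands (\<lambda>l. ?r k ^ l * ?g k l) (?C k) (?D k)" if k: "k \<in> {1..n}" for k
  proof -
    have g: "expands (?g k) (tau k * c (n - k)) (tau k * d (n - k))"
      using expands_mult[OF expands_ttuples IH[of "n - k"], of k] k by simp
    note gl = expands_tendsto[OF g]
    have nonneg: "0 \<le> ?r k" using pos[of n] pos[of "n - k"] by simp
    \<comment> \<open>A base equal to 1 feeds both coefficients, a base equal to 8/9 feeds only the
      second one, and a smaller base feeds neither.\<close>
    consider "k \<le> 4" "?r k = 1" "C k = tau k * c (n - k)" "D k = tau k * d (n - k)"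
      | "k \<le> 4" "?r k = 8/9" "C k = 0" "D k = tau k * c (n - k)"
      | "?r k < 8/9" "?C k = 0" "?D k = 0"
    proof (cases "k \<le> 4")
      case True
      then show ?thesis using that ratio[of k] k pos[of n] by (auto simp: field_simps)
    next
      case False
      then have "real k * 6 / 5 * max_order (n - k) \<le> max_order n"
        using max_order_add_ge5[of k "n - k"] k by simp
      \<comment> \<open>5/6 is the reciprocal of the 6/5 in \<open>max_order_add_ge5\<close>, and it
        lies below 8/9.\<close>
      then have "?r k \<le> 5/6" using pos[of n] by (simp add: field_simps)
      then have "?r k < 8/9" by (rule order.strict_trans1) simp
      then show ?thesis using False by (intro that(3)) simp_all
    qed
    then show ?thesis
    proof cases
      case 1
      then show ?thesis using g unfolding 1(2) by simp
    next
      case 2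
      then show ?thesis using expands_geometric_critical[OF gl] unfolding 2(2) by simp
    next
      case 3
      then show ?thesis using expands_geometric_small[OF gl nonneg] by (simp only:)
    qed
  qed
  then have "expands (\<lambda>l. 1 / real n * (\<Sum>k=1..n. ?r k ^ l * ?g k l)) (1 / real n * (\<Sum>k=1..n. ?C k)) (1 / real n * (\<Sum>k=1..n. ?D k))"
    by (intro expands_cmult expands_sum) auto
  moreover have "(\<lambda>l. 1 / real n * (\<Sum>k=1..n. ?r k ^ l * ?g k l)) = normalized n"
    using normalized_rec[OF n] by auto
  moreover have "(\<Sum>k=1..n. ?C k) = (\<Sum>k=1..min 4 n. C k)" "(\<Sum>k=1..n. ?D k) = (\<Sum>k=1..min 4 n. D k)"
    by (rule sum.mono_neutral_cong_right; auto)+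
  ultimately show ?thesis by simp
qed

subsection \<open>Coefficients of the expansion\<close>

text \<open>The value is the reciprocal of \<open>6 ^ (j - i) * (j - i)!\<close>, extended by 0 to \<open>j < i\<close>, so that
  the recurrences below hold without side conditions.\<close>
definition weight :: "nat \<Rightarrow> nat \<Rightarrow> real" where
  "weight i j = (if j < i then 0 else 1 / (6 ^ (j - i) * fact (j - i)))"

lemma weight_Suc_Suc [simp]: "weight (Suc i) (Suc j) = weight i j"
  by (simp add: weight_def)

lemma weight_rec: "weight i j = 6 * (real (Suc j) - real i) * weight i (Suc j)"
proof (cases "i \<le> j")
  case True
  then obtain m where "j = i + m" using le_Suc_ex by blast
  moreover have "1 + real m > 0" by simp
  ultimately show ?thesis
    by (simp add: weight_def Suc_diff_le del: of_nat_Suc fact_Suc)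
      (simp add: fact_Suc add.commute[of "real m"] divide_simps)
next
  case False
  then show ?thesis by (cases "i = Suc j") (auto simp: weight_def)
qed

text \<open>\<open>coeff1 n * n!\<close> is the number of abelian subgroups of maximal order. Such a group has orbits of
  size 3 together with, according to \<open>n mod 3\<close>, nothing, four points, or one orbit of size 2; the
  factor \<open>7/24\<close> is \<open>(4 + 3) / 4!\<close>, from the regular groups on four points and the pairs of transpositions.
  The second coefficient counts the groups of order \<open>8/9\<close> of the maximum, where two orbits of size 3
  are replaced by six further points in orbits of size 2 and 4.\<close>
definition coeff1 :: "nat \<Rightarrow> real" where
  "coeff1 n = (if n = 1 then 1 else if n mod 3 = 0 then weight 0 (n div 3)
     else if n mod 3 = 1 then 7/24 * weight 1 (n div 3) else 1/2 * weight 0 (n div 3))"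

definition coeff2 :: "nat \<Rightarrow> real" where
  "coeff2 n = (if n mod 3 = 0 then 5/48 * weight 2 (n div 3)
     else if n mod 3 = 1 then 41/3840 * weight 3 (n div 3) else 43/1152 * weight 2 (n div 3))"

text \<open>The third residue class is indexed by 3j + 4 to skip the exceptional index 1; the shift
  of the weight then gives index j in all three classes.\<close>

lemma coeff_closed:
  "coeff1 (3 * j) = weight 0 j" "coeff2 (3 * j) = 5/48 * weight 2 j"
  "coeff1 (3 * j + 2) = 1/2 * weight 0 j" "coeff2 (3 * j + 2) = 43/1152 * weight 2 j"
  "coeff1 (3 * j + 4) = 7/24 * weight 0 j" "coeff2 (3 * j + 4) = 41/3840 * weight 2 j"
proof -
  have m: "3 * j mod 3 = 0" "3 * j div 3 = j" "(3 * j + 2) mod 3 = 2" "(3 * j + 2) div 3 = j"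
    "(3 * j + 4) mod 3 = 1" "(3 * j + 4) div 3 = Suc j" by presburger+
  have "3 * j \<noteq> 1" by presburger
  then show "coeff1 (3 * j) = weight 0 j" by (simp add: coeff1_def)
  show "coeff2 (3 * j) = 5/48 * weight 2 j" by (simp add: coeff2_def)
  show "coeff1 (3 * j + 2) = 1/2 * weight 0 j" unfolding coeff1_def m by simp
  show "coeff2 (3 * j + 2) = 43/1152 * weight 2 j" unfolding coeff2_def m by simp
  show "coeff1 (3 * j + 4) = 7/24 * weight 0 j" unfolding coeff1_def m by simp
  show "coeff2 (3 * j + 4) = 41/3840 * weight 2 j" unfolding coeff2_def m by (simp add: eval_nat_numeral)
qed

lemma coeff_small:
  "coeff1 0 = 1" "coeff1 1 = 1" "coeff1 2 = 1/2" "coeff1 3 = 1/6" "coeff1 4 = 7/24" "coeff1 5 = 1/12"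
  "coeff2 0 = 0" "coeff2 1 = 0" "coeff2 2 = 0" "coeff2 3 = 0" "coeff2 4 = 0" "coeff2 5 = 0"
  by (simp_all add: coeff1_def coeff2_def weight_def)

lemma max_order_small:
  "max_order 0 = 1" "max_order 1 = 1" "max_order 2 = 2" "max_order 3 = 3" "max_order 4 = 4" "max_order 5 = 6"
  by (simp_all add: eval_nat_numeral)

lemma ctuples_empty: "ctuples l {} = {replicate l id}"
  by (auto simp: ctuples_def permutes_empty replicate_eqI)

lemma normalized_0: "normalized 0 = (\<lambda>_. 1)"
  by (auto simp: normalized_def N_eq lessThan_0 ctuples_empty)

lemma sum_1_4: "(\<Sum>k=1..4::nat. f k) = f 1 + f 2 + f 3 + (f 4 :: real)"
  by (simp add: eval_nat_numeral)

lemma cases_1_4: "1 \<le> (k::nat) \<Longrightarrow> k \<le> 4 \<Longrightarrow> k = 1 \<or> k = 2 \<or> k = 3 \<or> k = 4"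
  by auto

text \<open>The coefficients satisfy the recurrence of \<open>expands_normalized_step\<close>,
  checked separately in each residue class.\<close>

lemma expands_normalized: "expands (normalized n) (coeff1 n) (coeff2 n)"
proof (induction n rule: less_induct)
  case (less n)
  have step: "expands (normalized n) ((\<Sum>k=1..min 4 n. C k) / n) ((\<Sum>k=1..min 4 n. D k) / n)"
    if "n \<ge> 1" "\<And>k. k = 1 \<or> k = 2 \<or> k = 3 \<or> k = 4 \<Longrightarrow> k \<le> n \<Longrightarrow>
      (real k * max_order (n - k) = max_order n \<and> C k = tau k * coeff1 (n - k) \<and> D k = tau k * coeff2 (n - k)) \<or>
      (9 * (real k * max_order (n - k)) = 8 * max_order n \<and> C k = 0 \<and> D k = tau k * coeff1 (n - k)) \<or>
      (9 * (real k * max_order (n - k)) < 8 * max_order n \<and> C k = 0 \<and> D k = 0)" for C D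
    by (rule expands_normalized_step[OF that(1) less.IH], assumption) (rule that(2)[OF cases_1_4])
  have sum_2_3: "(\<Sum>k=1..2::nat. f k) = f 1 + f 2" "(\<Sum>k=1..3::nat. f k) = f 1 + f 2 + f 3" for f :: "nat \<Rightarrow> real"
    by (simp_all add: eval_nat_numeral)
  note small = coeff_small[unfolded One_nat_def] max_order_small[unfolded One_nat_def]
    tau_simps[unfolded One_nat_def] sum_1_4[unfolded One_nat_def] sum_2_3[unfolded One_nat_def]
  \<comment> \<open>From 6 on, the indices n - 1 to n - 4 are at least 2, so all of them have closed
    forms.\<close>
  have "n < 6 \<or> (\<exists>i. n = 3 * i + 6 \<or> n = 3 * i + 7 \<or> n = 3 * i + 8)" by presburger
  then consider "n = 0" | "n = 1" | "n = 2" | "n = 3" | "n = 4" | "n = 5"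
    | i where "n = 3 * i + 6" | i where "n = 3 * i + 7" | i where "n = 3 * i + 8" by fastforce
  then show ?case
  proof cases
    case 1
    then show ?thesis by (simp add: normalized_0 coeff_small expands_const)
  next
    \<comment> \<open>For n from 1 to 5 every base is 1 or below 8/9, so no second-order term
      arises.\<close>
    case 2
    have "expands (normalized n) ((\<Sum>k=1..min 4 n. 1) / n) ((\<Sum>k=1..min 4 n. 0) / n)"
      by (rule step) (auto simp: 2 small)
    then show ?thesis by (simp add: 2 small)
  next
    case 3
    have "expands (normalized n) ((\<Sum>k=1..min 4 n. if k = 2 then 1 else 0) / n) ((\<Sum>k=1..min 4 n. 0) / n)"
      by (rule step) (auto simp: 3 small)
    then show ?thesis by (simp add: 3 small)
  next
    case 4
    have "expands (normalized n) ((\<Sum>k=1..min 4 n. if k = 3 then 1/2 else 0) / n) ((\<Sum>k=1..min 4 n. 0) / n)"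
      by (rule step) (auto simp: 4 small)
    then show ?thesis by (simp add: 4 small)
  next
    case 5
    have "expands (normalized n) ((\<Sum>k=1..min 4 n. if k = 2 then 1/2 else if k = 4 then 2/3 else 0) / n) ((\<Sum>k=1..min 4 n. 0) / n)"
      by (rule step) (auto simp: 5 small)
    then show ?thesis by (simp add: 5 small)
  next
    case 6
    have "expands (normalized n) ((\<Sum>k=1..min 4 n. if k = 2 then 1/6 else if k = 3 then 1/4 else 0) / n) ((\<Sum>k=1..min 4 n. 0) / n)"
      by (rule step) (auto simp: 6 small)
    then show ?thesis by (simp add: 6 small)
  next
    case (7 i)
    have sub: "n - 1 = 3 * Suc i + 2" "n - 2 = 3 * i + 4" "n - 3 = 3 * Suc i" "n - 4 = 3 * i + 2" "n = 3 * Suc (Suc i)"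
      using 7 by auto
    have M: "max_order (n - 1) = 2 * 3 ^ (Suc i)" "max_order (n - 2) = 4 * 3 ^ i" "max_order (n - 3) = 3 ^ (Suc i)"
      "max_order (n - 4) = 2 * 3 ^ i" "max_order n = 3 ^ (Suc (Suc i))"
      by (simp_all only: sub(1-4) max_order_closed) (simp only: sub(5) max_order_closed)
    have K: "coeff1 (n - 1) = 1/2 * weight 0 (Suc i)" "coeff2 (n - 1) = 43/1152 * weight 2 (Suc i)"
      "coeff1 (n - 2) = 7/24 * weight 0 i" "coeff2 (n - 2) = 41/3840 * weight 2 i"
      "coeff1 (n - 3) = weight 0 (Suc i)" "coeff2 (n - 3) = 5/48 * weight 2 (Suc i)"
      "coeff1 (n - 4) = 1/2 * weight 0 i" "coeff2 (n - 4) = 43/1152 * weight 2 i"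
      by (simp_all only: sub(1-4) coeff_closed)
    note facts = M[unfolded One_nat_def] K[unfolded One_nat_def] tau_simps[unfolded One_nat_def]
    have Kn: "coeff1 n = weight 0 (Suc (Suc i))" "coeff2 n = 5/48 * weight 2 (Suc (Suc i))"
      by (simp_all only: sub(5) coeff_closed)
    have min4: "min 4 n = 4" using 7 by simp
    \<comment> \<open>For k = 1, 2, 3, 4 the bases are 2/3, 8/9, 1, 8/9.\<close>
    let ?C = "\<lambda>k::nat. if k = 3 then 1/2 * weight 0 (Suc i) else 0"
    let ?D = "\<lambda>k::nat. if k = 2 then 7/24 * weight 0 i else if k = 3 then 5/96 * weight 2 (Suc i)
      else if k = 4 then 1/3 * weight 0 i else 0"
    have "expands (normalized n) ((\<Sum>k=1..min 4 n. ?C k) / n) ((\<Sum>k=1..min 4 n. ?D k) / n)"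
    proof (rule step)
      fix k :: nat assume "k = 1 \<or> k = 2 \<or> k = 3 \<or> k = 4"
      then show "(real k * max_order (n - k) = max_order n \<and> ?C k = tau k * coeff1 (n - k) \<and> ?D k = tau k * coeff2 (n - k)) \<or>
      (9 * (real k * max_order (n - k)) = 8 * max_order n \<and> ?C k = 0 \<and> ?D k = tau k * coeff1 (n - k)) \<or>
      (9 * (real k * max_order (n - k)) < 8 * max_order n \<and> ?C k = 0 \<and> ?D k = 0)"
        by (elim disjE) (simp_all add: facts)
    qed (use 7 in simp)
    moreover have "(\<Sum>k=1..min 4 n. ?C k) / n = coeff1 n"
    proof -
      have "weight 0 (Suc i) = 6 * (real i + 2) * weight 0 (Suc (Suc i))"
        using weight_rec[of 0 "Suc i"] by (simp add: algebra_simps)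
      then show ?thesis unfolding min4 Kn sum_1_4 by (simp add: 7 field_simps)
    qed
    \<comment> \<open>In units of \<open>weight 0 i\<close> the sum is 5/8 + 5i/16 = 5/48 * 3 (i +
      2), and n = 3 (i + 2).\<close>
    moreover have "(\<Sum>k=1..min 4 n. ?D k) / n = coeff2 n"
    proof -
      have "weight 2 (Suc i) = 6 * real i * weight 0 i" "weight 2 (Suc (Suc i)) = weight 0 i"
        using weight_rec[of 2 "Suc i"] by (simp_all add: eval_nat_numeral)
      then show ?thesis unfolding min4 Kn sum_1_4 by (simp add: 7 field_simps)
    qed
    ultimately show ?thesis by simp
  next
    case (8 i)
    have sub: "n - 1 = 3 * Suc (Suc i)" "n - 2 = 3 * Suc i + 2" "n - 3 = 3 * i + 4" "n - 4 = 3 * Suc i" "n = 3 * Suc i + 4"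
      using 8 by auto
    have M: "max_order (n - 1) = 3 ^ (Suc (Suc i))" "max_order (n - 2) = 2 * 3 ^ (Suc i)" "max_order (n - 3) = 4 * 3 ^ i"
      "max_order (n - 4) = 3 ^ (Suc i)" "max_order n = 4 * 3 ^ (Suc i)"
      by (simp_all only: sub(1-4) max_order_closed) (simp only: sub(5) max_order_closed)
    have K: "coeff1 (n - 1) = weight 0 (Suc (Suc i))" "coeff2 (n - 1) = 5/48 * weight 2 (Suc (Suc i))"
      "coeff1 (n - 2) = 1/2 * weight 0 (Suc i)" "coeff2 (n - 2) = 43/1152 * weight 2 (Suc i)"
      "coeff1 (n - 3) = 7/24 * weight 0 i" "coeff2 (n - 3) = 41/3840 * weight 2 i"
      "coeff1 (n - 4) = weight 0 (Suc i)" "coeff2 (n - 4) = 5/48 * weight 2 (Suc i)"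
      by (simp_all only: sub(1-4) coeff_closed)
    note facts = M[unfolded One_nat_def] K[unfolded One_nat_def] tau_simps[unfolded One_nat_def]
    have Kn: "coeff1 n = 7/24 * weight 0 (Suc i)" "coeff2 n = 41/3840 * weight 2 (Suc i)"
      by (simp_all only: sub(5) coeff_closed)
    have min4: "min 4 n = 4" using 8 by simp
    \<comment> \<open>The bases are 3/4, 1, 1, 1, so the second coefficients come only from those of
      smaller n.\<close>
    let ?C = "\<lambda>k::nat. if k = 2 then 1/2 * weight 0 (Suc i) else if k = 3 then 7/48 * weight 0 i
      else if k = 4 then 2/3 * weight 0 (Suc i) else 0"
    let ?D = "\<lambda>k::nat. if k = 2 then 43/1152 * weight 2 (Suc i) else if k = 3 then 41/7680 * weight 2 i
      else if k = 4 then 5/72 * weight 2 (Suc i) else 0"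
    have "expands (normalized n) ((\<Sum>k=1..min 4 n. ?C k) / n) ((\<Sum>k=1..min 4 n. ?D k) / n)"
    proof (rule step)
      fix k :: nat assume "k = 1 \<or> k = 2 \<or> k = 3 \<or> k = 4"
      then show "(real k * max_order (n - k) = max_order n \<and> ?C k = tau k * coeff1 (n - k) \<and> ?D k = tau k * coeff2 (n - k)) \<or>
      (9 * (real k * max_order (n - k)) = 8 * max_order n \<and> ?C k = 0 \<and> ?D k = tau k * coeff1 (n - k)) \<or>
      (9 * (real k * max_order (n - k)) < 8 * max_order n \<and> ?C k = 0 \<and> ?D k = 0)"
        by (elim disjE) (simp_all add: facts)
    qed (use 8 in simp)
    moreover have "(\<Sum>k=1..min 4 n. ?C k) / n = coeff1 n"
    proof -
      have "weight 0 i = 6 * (real i + 1) * weight 0 (Suc i)"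
        using weight_rec[of 0 i] by (simp add: algebra_simps)
      then show ?thesis unfolding min4 Kn sum_1_4 by (simp add: 8 field_simps)
    qed
    \<comment> \<open>In units of \<open>weight 2 (Suc i)\<close> the sum is 41/384 + 41/1280 (i -
      1) = 41/3840 (3i + 7).\<close>
    moreover have "(\<Sum>k=1..min 4 n. ?D k) / n = coeff2 n"
    proof -
      have "weight 2 i = 6 * (real i - 1) * weight 2 (Suc i)"
        using weight_rec[of 2 i] by (simp add: algebra_simps)
      then show ?thesis unfolding min4 Kn sum_1_4 by (simp add: 8 field_simps)
    qed
    ultimately show ?thesis by simp
  next
    case (9 i)
    have sub: "n - 1 = 3 * Suc i + 4" "n - 2 = 3 * Suc (Suc i)" "n - 3 = 3 * Suc i + 2" "n - 4 = 3 * i + 4"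
      "n = 3 * Suc (Suc i) + 2"
      using 9 by auto
    have M: "max_order (n - 1) = 4 * 3 ^ (Suc i)" "max_order (n - 2) = 3 ^ (Suc (Suc i))" "max_order (n - 3) = 2 * 3 ^ (Suc i)"
      "max_order (n - 4) = 4 * 3 ^ i" "max_order n = 2 * 3 ^ (Suc (Suc i))"
      by (simp_all only: sub(1-4) max_order_closed) (simp only: sub(5) max_order_closed)
    have K: "coeff1 (n - 1) = 7/24 * weight 0 (Suc i)" "coeff2 (n - 1) = 41/3840 * weight 2 (Suc i)"
      "coeff1 (n - 2) = weight 0 (Suc (Suc i))" "coeff2 (n - 2) = 5/48 * weight 2 (Suc (Suc i))"
      "coeff1 (n - 3) = 1/2 * weight 0 (Suc i)" "coeff2 (n - 3) = 43/1152 * weight 2 (Suc i)"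
      "coeff1 (n - 4) = 7/24 * weight 0 i" "coeff2 (n - 4) = 41/3840 * weight 2 i"
      by (simp_all only: sub(1-4) coeff_closed)
    note facts = M[unfolded One_nat_def] K[unfolded One_nat_def] tau_simps[unfolded One_nat_def]
    have Kn: "coeff1 n = 1/2 * weight 0 (Suc (Suc i))" "coeff2 n = 43/1152 * weight 2 (Suc (Suc i))"
      by (simp_all only: sub(5) coeff_closed)
    have min4: "min 4 n = 4" using 9 by simp
    \<comment> \<open>The bases are 2/3, 1, 1, 8/9.\<close>
    let ?C = "\<lambda>k::nat. if k = 2 then weight 0 (Suc (Suc i)) else if k = 3 then 1/4 * weight 0 (Suc i) else 0"
    let ?D = "\<lambda>k::nat. if k = 2 then 5/48 * weight 2 (Suc (Suc i)) else if k = 3 then 43/2304 * weight 2 (Suc i)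
      else if k = 4 then 7/36 * weight 0 i else 0"
    have "expands (normalized n) ((\<Sum>k=1..min 4 n. ?C k) / n) ((\<Sum>k=1..min 4 n. ?D k) / n)"
    proof (rule step)
      fix k :: nat assume "k = 1 \<or> k = 2 \<or> k = 3 \<or> k = 4"
      then show "(real k * max_order (n - k) = max_order n \<and> ?C k = tau k * coeff1 (n - k) \<and> ?D k = tau k * coeff2 (n - k)) \<or>
      (9 * (real k * max_order (n - k)) = 8 * max_order n \<and> ?C k = 0 \<and> ?D k = tau k * coeff1 (n - k)) \<or>
      (9 * (real k * max_order (n - k)) < 8 * max_order n \<and> ?C k = 0 \<and> ?D k = 0)"
        by (elim disjE) (simp_all add: facts)
    qed (use 9 in simp)
    moreover have "(\<Sum>k=1..min 4 n. ?C k) / n = coeff1 n"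
    proof -
      have "weight 0 (Suc i) = 6 * (real i + 2) * weight 0 (Suc (Suc i))"
        using weight_rec[of 0 "Suc i"] by (simp add: algebra_simps)
      then show ?thesis unfolding min4 Kn sum_1_4 by (simp add: 9 field_simps)
    qed
    \<comment> \<open>In units of \<open>weight 0 i\<close> the sum is 43/144 + 43i/384 = 43/1152
      (3i + 8).\<close>
    moreover have "(\<Sum>k=1..min 4 n. ?D k) / n = coeff2 n"
    proof -
      have "weight 2 (Suc i) = 6 * real i * weight 0 i" "weight 2 (Suc (Suc i)) = weight 0 i"
        using weight_rec[of 2 "Suc i"] by (simp_all add: eval_nat_numeral)
      then show ?thesis unfolding min4 Kn sum_1_4 by (simp add: 9 field_simps)
    qed
    ultimately show ?thesis by simp
  qed
qed

lemma coeff1_pos: "coeff1 n > 0"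
proof -
  have "n = 1 \<or> (\<exists>j. n = 3 * j \<or> n = 3 * j + 2 \<or> n = 3 * j + 4)" by presburger
  moreover have "weight 0 j > 0" for j by (simp add: weight_def)
  ultimately show ?thesis
    by (elim disjE exE) (simp_all only: coeff_closed coeff_small, simp_all)
qed

subsection \<open>The sign of Delta\<close>

lemma Delta_normalized:
  "Delta l n = (max_order n ^ 2) ^ l * normalized n l ^ 2
    - (max_order (n - 1) * max_order (n + 1)) ^ l * (normalized (n - 1) l * normalized (n + 1) l)"
proof -
  have "max_order m \<noteq> 0" for m using max_order_pos[of m] by simp
  then show ?thesis
    by (simp add: Delta_def normalized_def power_mult_distrib power_divide power_mult[symmetric] mult.commute)
qed

lemma finite_not_eventually:
  assumes "eventually P sequentially" "\<And>l. P l \<Longrightarrow> Q l"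
  shows "finite {l. l \<ge> 1 \<and> \<not> Q l}"
proof -
  have "finite {l. \<not> P l}"
    using assms(1) by (simp add: cofinite_eq_sequentially[symmetric] eventually_cofinite)
  then show ?thesis by (rule rev_finite_subset) (use assms(2) in auto)
qed

text \<open>After the larger power is factored out, the other product dies geometrically and the
  bracket tends to \<open>coeff1 n ^ 2\<close>, which is positive.\<close>

lemma Delta_pos_if_ratio_less:
  assumes "max_order (n - 1) * max_order (n + 1) < max_order n ^ 2"
  shows "eventually (\<lambda>l. Delta l n > 0) sequentially"
proof -
  define r where "r = max_order (n - 1) * max_order (n + 1) / max_order n ^ 2"
  note pos = max_order_pos[of n] max_order_pos[of "n - 1"] max_order_pos[of "n + 1"]
  have r: "0 \<le> r" "r < 1" using assms pos by (simp_all add: r_def)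
  have eq: "Delta l n = (max_order n ^ 2) ^ l * (normalized n l ^ 2 - r ^ l * (normalized (n - 1) l * normalized (n + 1) l))" for l
    using pos unfolding Delta_normalized r_def by (simp add: power_divide right_diff_distrib)
  have "(\<lambda>l. normalized n l ^ 2 - r ^ l * (normalized (n - 1) l * normalized (n + 1) l))
    \<longlonglongrightarrow> coeff1 n ^ 2 - 0 * (coeff1 (n - 1) * coeff1 (n + 1))"
    using r by (intro tendsto_intros LIMSEQ_power_zero expands_tendsto[OF expands_normalized]) auto
  then have "eventually (\<lambda>l. normalized n l ^ 2 - r ^ l * (normalized (n - 1) l * normalized (n + 1) l) > 0) sequentially"
    by (rule order_tendstoD(1)) (use coeff1_pos[of n] in simp)
  then show ?thesis
    by eventually_elim (use pos in \<open>simp add: eq\<close>)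
qed

text \<open>Here the product of the neighbours dominates, and the bracket tends to minus the product
  of their leading coefficients.\<close>

lemma Delta_neg_if_ratio_greater:
  assumes "max_order (n - 1) * max_order (n + 1) > max_order n ^ 2"
  shows "eventually (\<lambda>l. Delta l n < 0) sequentially"
proof -
  let ?M = "max_order (n - 1) * max_order (n + 1)"
  define r where "r = max_order n ^ 2 / ?M"
  note pos = max_order_pos[of n] max_order_pos[of "n - 1"] max_order_pos[of "n + 1"]
  have M: "?M > 0" using pos by simp
  have r: "0 \<le> r" "r < 1" using assms pos M by (simp_all add: r_def)
  have "(max_order n ^ 2) ^ l = ?M ^ l * r ^ l" for l
    using M unfolding power_mult_distrib[symmetric] r_def by (metis less_irrefl nonzero_mult_div_cancel_left times_divide_eq_right)
  then have eq: "Delta l n = ?M ^ l * (r ^ l * normalized n l ^ 2 - normalized (n - 1) l * normalized (n + 1) l)" for l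
    unfolding Delta_normalized by (simp only: right_diff_distrib mult.assoc)
  have "(\<lambda>l. r ^ l * normalized n l ^ 2 - normalized (n - 1) l * normalized (n + 1) l)
    \<longlonglongrightarrow> 0 * coeff1 n ^ 2 - coeff1 (n - 1) * coeff1 (n + 1)"
    using r by (intro tendsto_intros LIMSEQ_power_zero expands_tendsto[OF expands_normalized]) auto
  then have "eventually (\<lambda>l. r ^ l * normalized n l ^ 2 - normalized (n - 1) l * normalized (n + 1) l < 0) sequentially"
    by (rule order_tendstoD(2)) (use coeff1_pos[of "n - 1"] coeff1_pos[of "n + 1"] in simp)
  then show ?thesis
    by eventually_elim (use M in \<open>simp only: eq mult_less_0_iff zero_less_power simp_thms\<close>)
qed

text \<open>With equal bases the common power factors out and leaves a bracket with expansion c, d.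
  The coefficient d of \<open>(8/9) ^ l\<close> decides when c vanishes.\<close>

lemma Delta_sign_if_ratio_eq:
  assumes "max_order (n - 1) * max_order (n + 1) = max_order n ^ 2"
  defines "c \<equiv> coeff1 n ^ 2 - coeff1 (n - 1) * coeff1 (n + 1)"
    and "d \<equiv> 2 * coeff1 n * coeff2 n - (coeff2 (n - 1) * coeff1 (n + 1) + coeff1 (n - 1) * coeff2 (n + 1))"
  shows "c > 0 \<Longrightarrow> eventually (\<lambda>l. Delta l n > 0) sequentially"
    and "c < 0 \<Longrightarrow> eventually (\<lambda>l. Delta l n < 0) sequentially"
    and "c = 0 \<Longrightarrow> d < 0 \<Longrightarrow> eventually (\<lambda>l. Delta l n < 0) sequentially"
proof -
  \<comment> \<open>The difference is written as a sum with factor -1 to match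
    \<open>expands_add\<close> and \<open>expands_cmult\<close>.\<close>
  let ?f = "\<lambda>l. normalized n l * normalized n l + - 1 * (normalized (n - 1) l * normalized (n + 1) l)"
  have M: "max_order n ^ 2 > 0" using max_order_pos[of n] by simp
  have eq: "Delta l n = (max_order n ^ 2) ^ l * ?f l" for l
    unfolding Delta_normalized assms(1) by (simp add: algebra_simps power2_eq_square)
  have "expands ?f (coeff1 n * coeff1 n + - 1 * (coeff1 (n - 1) * coeff1 (n + 1)))
    ((coeff2 n * coeff1 n + coeff1 n * coeff2 n) + - 1 * (coeff2 (n - 1) * coeff1 (n + 1) + coeff1 (n - 1) * coeff2 (n + 1)))"
    by (intro expands_add expands_cmult expands_mult expands_normalized)
  then have e: "expands ?f c d" by (simp add: c_def d_def power2_eq_square algebra_simps)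
  show "eventually (\<lambda>l. Delta l n > 0) sequentially" if "c > 0"
    using order_tendstoD(1)[OF expands_tendsto[OF e] that]
    by eventually_elim (use M in \<open>simp only: eq zero_less_mult_iff zero_less_power simp_thms\<close>)
  show "eventually (\<lambda>l. Delta l n < 0) sequentially" if "c < 0"
    using order_tendstoD(2)[OF expands_tendsto[OF e] that]
    by eventually_elim (use M in \<open>simp only: eq mult_less_0_iff zero_less_power simp_thms\<close>)
  show "eventually (\<lambda>l. Delta l n < 0) sequentially" if "c = 0" "d < 0"
  proof -
    have "eventually (\<lambda>l. (?f l - c) * (9/8) ^ l < 0) sequentially"
      using e that(2) unfolding expands_def by (rule order_tendstoD(2))
    then show ?thesis
    proof eventually_elim
      case (elim l)
      then have "?f l < 0" using that(1) by (simp add: mult_less_0_iff)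
      then show ?case using M by (simp only: eq mult_less_0_iff zero_less_power simp_thms)
    qed
  qed
qed

text \<open>In units of \<open>weight 0 (Suc j) ^ 2\<close> the difference is 1/4 - 7 (j + 1) / (24
  (j + 2)). It vanishes at j = 5, that is at n = 20.\<close>

lemma coeff1_discriminant:
  "coeff1 (3 * j + 5) ^ 2 - coeff1 (3 * j + 4) * coeff1 (3 * j + 6)
    = weight 0 (Suc j) ^ 2 * (5 - real j) / (24 * (real j + 2))"
proof -
  have 1: "weight 0 j = 6 * (real j + 1) * weight 0 (Suc j)"
    using weight_rec[of 0 j] by (simp add: algebra_simps)
  have "weight 0 (Suc j) = 6 * (real j + 2) * weight 0 (Suc (Suc j))"
    using weight_rec[of 0 "Suc j"] by (simp add: algebra_simps)
  then have 2: "weight 0 (Suc (Suc j)) = weight 0 (Suc j) / (6 * (real j + 2))"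
    by (simp add: field_simps)
  have c: "coeff1 (3 * j + 5) = 1/2 * weight 0 (Suc j)" "coeff1 (3 * j + 6) = weight 0 (Suc (Suc j))"
    using coeff_closed(3)[of "Suc j"] coeff_closed(1)[of "Suc (Suc j)"] by (simp_all add: algebra_simps)
  show ?thesis unfolding c coeff_closed(5) 1 2 by (simp add: field_simps power2_eq_square)
qed

theorem theorem1p2:
  fixes n :: nat
  assumes "n \<ge> 2"
  shows "(n mod 3 = 0 \<longrightarrow> finite {l. l \<ge> 1 \<and> \<not> (Delta l n \<ge> 0)})
       \<and> (n mod 3 = 1 \<longrightarrow> finite {l. l \<ge> 1 \<and> \<not> (Delta l n < 0)})
       \<and> (n mod 3 = 2 \<and> n < 20 \<longrightarrow> finite {l. l \<ge> 1 \<and> \<not> (Delta l n \<ge> 0)})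
       \<and> (n mod 3 = 2 \<and> n \<ge> 20 \<longrightarrow> finite {l. l \<ge> 1 \<and> \<not> (Delta l n < 0)})"
proof -
  have pos: ?thesis if "eventually (\<lambda>l. Delta l n > 0) sequentially" "n mod 3 = 0 \<or> n mod 3 = 2 \<and> n < 20"
    using finite_not_eventually[OF that(1), of "\<lambda>l. Delta l n \<ge> 0"] that(2) by auto
  have neg: ?thesis if "eventually (\<lambda>l. Delta l n < 0) sequentially" "n mod 3 = 1 \<or> n mod 3 = 2 \<and> n \<ge> 20"
    using finite_not_eventually[OF that(1), of "\<lambda>l. Delta l n < 0"] that(2) by auto
  \<comment> \<open>The cases 2 and 3 stand apart: for n = 2 the neighbour 1 has no closed form, and
    n = 3 lies below the range of 3j + 6.\<close>
  have "n = 2 \<or> n = 3 \<or> (\<exists>j. n = 3 * j + 4 \<or> n = 3 * j + 5 \<or> n = 3 * j + 6)" using assms by presburger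
  then consider "n = 2" | "n = 3" | j where "n = 3 * j + 4" | j where "n = 3 * j + 5" | j where "n = 3 * j + 6"
    by blast
  then show ?thesis
  proof cases
    case 1
    have "max_order (n - 1) * max_order (n + 1) < max_order n ^ 2"
      by (simp add: 1 max_order_small[simplified])
    then show ?thesis using 1 by (intro pos Delta_pos_if_ratio_less) simp_all
  next
    case 2
    have "max_order (n - 1) * max_order (n + 1) < max_order n ^ 2"
      by (simp add: 2 max_order_small[simplified])
    then show ?thesis using 2 by (intro pos Delta_pos_if_ratio_less) simp_all
  next
    case (3 j)
    have sub: "n - 1 = 3 * Suc j" "n + 1 = 3 * Suc j + 2" using 3 by auto
    \<comment> \<open>Up to the factor \<open>9 ^ j\<close> this is 18 > 16.\<close>
    have "max_order (n - 1) * max_order (n + 1) > max_order n ^ 2"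
      unfolding sub max_order_closed unfolding 3 max_order_closed by (simp add: power2_eq_square)
    moreover have "n mod 3 = 1" using 3 by presburger
    ultimately show ?thesis by (intro neg Delta_neg_if_ratio_greater) simp_all
  next
    case (4 j)
    have sub: "n - 1 = 3 * j + 4" "n + 1 = 3 * j + 6" "n = 3 * Suc j + 2" "3 * j + 6 = 3 * Suc (Suc j)" using 4 by auto
    \<comment> \<open>Both sides are 36 times \<open>9 ^ j\<close>.\<close>
    have eq: "max_order (n - 1) * max_order (n + 1) = max_order n ^ 2"
      unfolding sub(1,2) sub(4) max_order_closed unfolding sub(3) max_order_closed by (simp add: power2_eq_square)
    have m: "n mod 3 = 2" using 4 by presburger
    have w: "weight 0 (Suc j) ^ 2 / (24 * (real j + 2)) > 0" by (simp add: weight_def)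
    have disc: "coeff1 n ^ 2 - coeff1 (n - 1) * coeff1 (n + 1) = weight 0 (Suc j) ^ 2 / (24 * (real j + 2)) * (5 - real j)"
      unfolding sub(1,2) unfolding 4 coeff1_discriminant by simp
    consider "j < 5" | "j = 5" | "j > 5" by linarith
    then show ?thesis
    proof cases
      case 1
      then have "coeff1 n ^ 2 - coeff1 (n - 1) * coeff1 (n + 1) > 0"
        unfolding disc by (intro mult_pos_pos[OF w]) simp
      then show ?thesis using 1 4 m by (intro pos Delta_sign_if_ratio_eq(1)[OF eq]) auto
    next
      case 2
      \<comment> \<open>At n = 20 the leading terms cancel, and the second-order coefficient is
        evaluated numerically.\<close>
      have "2 * coeff1 n * coeff2 n - (coeff2 (n - 1) * coeff1 (n + 1) + coeff1 (n - 1) * coeff2 (n + 1)) < 0"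
        unfolding 4 2 coeff1_def coeff2_def weight_def by (simp add: fact_numeral)
      then show ?thesis using 2 4 m disc by (intro neg Delta_sign_if_ratio_eq(3)[OF eq]) auto
    next
      case 3
      then have "coeff1 n ^ 2 - coeff1 (n - 1) * coeff1 (n + 1) < 0"
        unfolding disc by (intro mult_pos_neg[OF w]) simp
      then show ?thesis using 3 4 m by (intro neg Delta_sign_if_ratio_eq(2)[OF eq]) auto
    qed
  next
    case (5 j)
    have sub: "n - 1 = 3 * Suc j + 2" "n + 1 = 3 * Suc j + 4" "n = 3 * Suc (Suc j)" using 5 by auto
    \<comment> \<open>Up to the factor \<open>9 ^ j\<close> this is 72 < 81.\<close>
    have "max_order (n - 1) * max_order (n + 1) < max_order n ^ 2"
      unfolding sub(1,2) max_order_closed unfolding sub(3) max_order_closed by (simp add: power2_eq_square)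
    moreover have "n mod 3 = 0" using 5 by presburger
    ultimately show ?thesis by (intro pos Delta_pos_if_ratio_less) simp_all
  qed
qed

end
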